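(* Let $m,n\ge 1$, $q=\min\{m,n\}$, $1\le k\le q$, and let $F$ be a complex $m\times n$ matrix. Given a singular value decomposition $F=V\Sigma W^*$, the partial isometry $$U_k=V\begin{bmatrix} I_k & 0\\ 0 & 0_{m-k,n-k}\end{bmatrix}W^*$$ belongs to $\mathcal{I}_{m,n}^k$ and satisfies $$\|F-U_k\|_\Phi=\min\{\,\|F-X\|_\Phi \,:\, X\in\mathcal{I}_{m,n}^k\,\}$$ for every unitarily invariant norm $\|\cdot\|_\Phi$ on the space of complex $m\times n$ matrices.
   Context: A complex $m\times n$ matrix $X$ is a partial isometry if $\|Xf\|=\|f\|$ for all $f\in\ker(X)^\perp$; $\mathcal{I}_{m,n}^k$ denotes the set of $m\times n$ partial isometries of rank $k$. For $F$ of rank $r$, $s_1(F)\ge\dots\ge s_q(F)\ge 0$ are the singular values of $F$ (the $q$ largest eigenvalues of $(F^*F)^{1/2}$, with multiplicity). A singular value decomposition (SVD) of $F$ is a factorization $F=V\Sigma W^*$ with $V$ an $m\times m$ unitary matrix, $W$ an $n\times n$ unitary matrix, and $\Sigma=\begin{bmatrix}\Sigma_r&0\\0&0_{m-r,n-r}\end{bmatrix}$, $\Sigma_r=\mathrm{diag}(s_1(F),\dots,s_r(F))$. A symmetric gauge function is a norm $\Phi$ on $\mathbb{R}^q$ with $\Phi(x_1,\dots,x_q)=\Phi(|x_{\sigma(1)}|,\dots,|x_{\sigma(q)}|)$ for every permutation $\sigma$ of $\{1,\dots,q\}$. The unitarily invariant norms are exactly the norms $\|F\|_\Phi=\Phi(s_1(F),\dots,s_q(F))$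 with $\Phi$ a symmetric gauge function on $\mathbb{R}^q$. *)

theory Defs
  imports
    "Jordan_Normal_Form.Schur_Decomposition"
    "Jordan_Normal_Form.Matrix_Kernel"
    "Jordan_Normal_Form.DL_Rank"
    "HOL-Combinatorics.Permutations"
begin

definition l2_norm :: "complex vec \<Rightarrow> real" where
  "l2_norm v = sqrt (Re (v \<bullet>c v))"

definition orth_compl :: "nat \<Rightarrow> complex vec set \<Rightarrow> complex vec set" where
  "orth_compl n S = {f \<in> carrier_vec n. \<forall>g\<in>S. f \<bullet>c g = 0}"

definition partial_isometry :: "complex mat \<Rightarrow> bool" where
  "partial_isometry X \<longleftrightarrow>
     (\<forall>f \<in> orth_compl (dim_col X) (mat_kernel X). l2_norm (X *\<^sub>v f) = l2_norm f)"

definition partial_isometries :: "nat \<Rightarrow> nat \<Rightarrow> nat \<Rightarrow> complex mat set" where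
  "partial_isometries m n k =
     {X \<in> carrier_mat m n. partial_isometry X \<and> vec_space.rank m X = k}"

definition unitary_mat :: "nat \<Rightarrow> complex mat \<Rightarrow> bool" where
  "unitary_mat n U \<longleftrightarrow>
     U \<in> carrier_mat n n \<and> mat_adjoint U * U = 1\<^sub>m n \<and> U * mat_adjoint U = 1\<^sub>m n"

definition psd_mat :: "complex mat \<Rightarrow> bool" where
  "psd_mat P \<longleftrightarrow> square_mat P \<and> mat_adjoint P = P \<and>
     (\<forall>v \<in> carrier_vec (dim_row P). 0 \<le> Re ((P *\<^sub>v v) \<bullet>c v))"

text \<open>The positive semidefinite square root; it is meaningful only for a positive semidefinite
  argument, for which existence and uniqueness hold.\<close>

definition psd_sqrt :: "complex mat \<Rightarrow> complex mat" where
  "psd_sqrt A = (THE P. psd_mat P \<and> P * P = A)"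

text \<open>The eigenvalues, listed in decreasing order with (algebraic) multiplicity, of a matrix whose
  eigenvalues are real. For Hermitian matrices algebraic and geometric multiplicities agree.\<close>

definition eigenvalues_desc :: "complex mat \<Rightarrow> real list" where
  "eigenvalues_desc A = rev (sorted_list_of_multiset (image_mset Re (proots (char_poly A))))"

text \<open>Indices start at 0: the singular values \<open>s\<^sub>1(F), \<dots>, s\<^sub>q(F)\<close> of an \<open>m \<times> n\<close> matrix, with
  \<open>q = min m n\<close>, are \<open>singular_value F 0, \<dots>, singular_value F (q - 1)\<close>.\<close>

definition singular_value :: "complex mat \<Rightarrow> nat \<Rightarrow> real" where
  "singular_value F i = eigenvalues_desc (psd_sqrt (mat_adjoint F * F)) ! i"

definition singular_values :: "complex mat \<Rightarrow> real vec" where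
  "singular_values F = vec (min (dim_row F) (dim_col F)) (singular_value F)"

definition corner_mat :: "nat \<Rightarrow> nat \<Rightarrow> nat \<Rightarrow> complex mat \<Rightarrow> complex mat" where
  "corner_mat m n r D =
     four_block_mat D (0\<^sub>m r (n - r)) (0\<^sub>m (m - r) r) (0\<^sub>m (m - r) (n - r))"

definition is_svd ::
  "nat \<Rightarrow> nat \<Rightarrow> complex mat \<Rightarrow> complex mat \<Rightarrow> complex mat \<Rightarrow> complex mat \<Rightarrow> bool" where
  "is_svd m n F V S W \<longleftrightarrow>
     unitary_mat m V \<and> unitary_mat n W \<and>
     (let r = vec_space.rank m F
      in S = corner_mat m n r (mat_diag r (\<lambda>i. complex_of_real (singular_value F i)))) \<and>
     F = V * S * mat_adjoint W"

definition norm_on_Rn :: "nat \<Rightarrow> (real vec \<Rightarrow> real) \<Rightarrow> bool" where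
  "norm_on_Rn q \<Phi> \<longleftrightarrow>
     (\<forall>x \<in> carrier_vec q. 0 \<le> \<Phi> x \<and> (\<Phi> x = 0 \<longleftrightarrow> x = 0\<^sub>v q)) \<and>
     (\<forall>x \<in> carrier_vec q. \<forall>c. \<Phi> (c \<cdot>\<^sub>v x) = \<bar>c\<bar> * \<Phi> x) \<and>
     (\<forall>x \<in> carrier_vec q. \<forall>y \<in> carrier_vec q. \<Phi> (x + y) \<le> \<Phi> x + \<Phi> y)"

definition symmetric_gauge :: "nat \<Rightarrow> (real vec \<Rightarrow> real) \<Rightarrow> bool" where
  "symmetric_gauge q \<Phi> \<longleftrightarrow> norm_on_Rn q \<Phi> \<and>
     (\<forall>x \<in> carrier_vec q. \<forall>\<sigma>. \<sigma> permutes {..<q} \<longrightarrow> \<Phi> x = \<Phi> (vec q (\<lambda>i. \<bar>x $ \<sigma> i\<bar>)))"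

text \<open>For \<open>\<Phi>\<close> ranging over the symmetric gauge functions on \<open>\<real>\<^sup>q\<close>, \<open>q = min m n\<close>, these are exactly the
  unitarily invariant norms on the complex \<open>m \<times> n\<close> matrices.\<close>

definition ui_norm :: "(real vec \<Rightarrow> real) \<Rightarrow> complex mat \<Rightarrow> real" where
  "ui_norm \<Phi> F = \<Phi> (singular_values F)"

end

theory Submission
  imports Defs
begin

text \<open>Two classical facts carry the proof. Write \<open>s(A)\<close> for the vector of the first \<open>q = min m n\<close> singular
values and \<open>z\<^sub>+ = max 0 z\<close>.

Mirsky's inequality says that \<open>\<bar>s(A) - s(B)\<bar>\<close> is weakly majorized by \<open>s(A - B)\<close>. Ky Fan's dominance
principle says that a symmetric gauge function respects weak majorization of nonnegative vectors.
Together they give \<open>\<Phi>(\<bar>s(F) - s(X)\<bar>) \<le> \<parallel>F - X\<parallel>\<close> for all \<open>X\<close>. A partial isometry of rank \<open>k\<close> has singular values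
\<open>t = (1, \<dots>, 1, 0, \<dots>, 0)\<close> with \<open>k\<close> ones, so \<open>\<Phi>(\<bar>s(F) - t\<bar>)\<close> is a lower bound that does not depend on \<open>X\<close>. It is
attained by \<open>U\<close>: in the bases given by \<open>V\<close> and \<open>W\<close> the matrix \<open>F - U\<close> is diagonal with entries
\<open>s\<^sub>i(F) - t\<^sub>i\<close>, hence its singular values are the numbers \<open>\<bar>s\<^sub>i(F) - t\<^sub>i\<bar>\<close> in decreasing order.

Weak majorization of \<open>x\<close> by \<open>y\<close> is used in the form \<open>\<Sum>(x\<^sub>i - \<tau>)\<^sub>+ \<le> \<Sum>(y\<^sub>i - \<tau>)\<^sub>+\<close> for all \<open>\<tau> \<ge> 0\<close>. This form
does not mention the order of the entries, so that the differences \<open>\<bar>s\<^sub>i(A) - s\<^sub>i(B)\<bar>\<close> need not be sorted, and it is what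
the following argument for Mirsky's inequality (lemma \<open>mirsky_excess\<close>) produces. The Hermitian dilation of \<open>A\<close> is the
block matrix \<open>H(A)\<close> with off-diagonal blocks \<open>A\<close> and \<open>A\<^sup>*\<close>; its eigenvalues are \<open>\<plusminus>s\<^sub>i(A)\<close> and zeros.
Cutting the singular values of \<open>A - B\<close> at \<open>\<tau>\<close> gives a positive semidefinite matrix \<open>E\<close> with
\<open>H(A - B) \<le> \<tau> + E\<close> and trace \<open>\<Sum>(s\<^sub>i(A - B) - \<tau>)\<^sub>+\<close>. The matrix \<open>G = H(B) + E\<close> lies above both \<open>H(B)\<close> and
\<open>H(A) - \<tau>\<close>, so each eigenvalue of \<open>G\<close> is at least the corresponding eigenvalue of these two matrices. Adding
the \<open>i\<close>-th largest and the \<open>i\<close>-th smallest eigenvalue of \<open>G\<close> gives at least \<open>(\<bar>s\<^sub>i(A) - s\<^sub>i(B)\<bar> - \<tau>)\<^sub>+\<close>, and the sum of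
all eigenvalues is the trace of \<open>G\<close>, which is the trace of \<open>E\<close>.

Ky Fan's principle (lemma \<open>symmetric_gauge_weak_majorization\<close>) follows by moving from \<open>y\<close> to \<open>x\<close> through
finitely many averaging steps, none of which increases \<open>\<Phi>\<close>.

Singular values are defined through the positive semidefinite square root of \<open>A\<^sup>*A\<close> and the roots of a
characteristic polynomial. The spectral theorem, the existence of a full singular value decomposition,
and the computation of the singular values of a matrix that is diagonal up to unitary factors (lemma
\<open>singular_values_of_rect_diag\<close>) reduce all statements about them to coordinates.\<close>

section \<open>Adjoints, unitary matrices and coordinates\<close>

lemma mat_adjoint_dim [simp]:
  "dim_row (mat_adjoint A) = dim_col A" "dim_col (mat_adjoint A) = dim_row A"
  by (auto simp: mat_adjoint_def)

lemma mat_adjoint_carrier [simp]: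
  "mat_adjoint A \<in> carrier_mat n m \<longleftrightarrow> dim_row A = m \<and> dim_col A = n"
  by (metis carrier_matD carrier_matI mat_adjoint_dim)

lemma mat_adjoint_index [simp]:
  fixes A :: "complex mat"
  shows "i < dim_col A \<Longrightarrow> j < dim_row A \<Longrightarrow> mat_adjoint A $$ (i, j) = cnj (A $$ (j, i))"
  by (auto simp: mat_adjoint_def mat_of_rows_def conjugate_complex_def)

lemma mat_adjoint_adjoint [simp]: "mat_adjoint (mat_adjoint A) = (A :: complex mat)"
  by (rule eq_matI) auto

lemma mat_adjoint_mult:
  fixes A B :: "complex mat"
  assumes "A \<in> carrier_mat m n" "B \<in> carrier_mat n p"
  shows "mat_adjoint (A * B) = mat_adjoint B * mat_adjoint A"
  using assms
  by (intro eq_matI) (auto simp: scalar_prod_def mult.commute intro!: sum.cong)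

lemma cscalar_sum:
  fixes x y :: "complex vec"
  assumes "x \<in> carrier_vec n" "y \<in> carrier_vec n"
  shows "x \<bullet>c y = (\<Sum>i<n. x $ i * cnj (y $ i))"
  using assms by (auto simp: scalar_prod_def conjugate_complex_def atLeast0LessThan)

lemma mult_mat_vec_carrier_iff [simp]:
  "A *\<^sub>v v \<in> carrier_vec m \<longleftrightarrow> dim_row A = m"
  by (metis carrier_vecD carrier_vecI dim_mult_mat_vec)

lemma mult_mat_vec_index:
  assumes "A \<in> carrier_mat m n" "v \<in> carrier_vec n" "i < m"
  shows "(A *\<^sub>v v) $ i = (\<Sum>j<n. A $$ (i, j) * v $ j)"
  using assms by (auto simp: scalar_prod_def atLeast0LessThan)

lemma mult_mat_index:
  assumes "A \<in> carrier_mat m n" "B \<in> carrier_mat n p" "i < m" "k < p"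
  shows "(A * B) $$ (i, k) = (\<Sum>j<n. A $$ (i, j) * B $$ (j, k))"
  using assms by (auto simp: scalar_prod_def atLeast0LessThan)

lemma cscalar_adjoint:
  fixes A :: "complex mat"
  assumes A: "A \<in> carrier_mat m n" and x: "x \<in> carrier_vec n" and y: "y \<in> carrier_vec m"
  shows "(A *\<^sub>v x) \<bullet>c y = x \<bullet>c (mat_adjoint A *\<^sub>v y)"
proof -
  have "(A *\<^sub>v x) \<bullet>c y = (\<Sum>i<m. \<Sum>j<n. A $$ (i, j) * x $ j * cnj (y $ i))"
    using assms by (subst cscalar_sum[of _ m]) (auto simp: mult_mat_vec_index sum_distrib_right simp del: index_mult_mat_vec)
  also have "\<dots> = (\<Sum>j<n. \<Sum>i<m. A $$ (i, j) * x $ j * cnj (y $ i))"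
    by (rule sum.swap)
  also have "\<dots> = x \<bullet>c (mat_adjoint A *\<^sub>v y)"
    using assms by (subst cscalar_sum[of _ n])
      (auto simp: mult_mat_vec_index[of _ n m] sum_distrib_left mult_ac simp del: index_mult_mat_vec intro!: sum.cong)
  finally show ?thesis .
qed

text \<open>The square of the Euclidean norm as a real number, which keeps square roots and real parts out of
the calculations.\<close>

definition sqnorm :: "complex vec \<Rightarrow> real" where
  "sqnorm v = (\<Sum>i<dim_vec v. (cmod (v $ i))\<^sup>2)"

lemma sqnorm_carrier: "v \<in> carrier_vec n \<Longrightarrow> sqnorm v = (\<Sum>i<n. (cmod (v $ i))\<^sup>2)"
  by (auto simp: sqnorm_def)

lemma sqnorm_nonneg [simp]: "0 \<le> sqnorm v"
  by (auto simp: sqnorm_def intro: sum_nonneg)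

lemma cscalar_self: "v \<bullet>c v = complex_of_real (sqnorm v)"
  by (subst cscalar_sum[of _ "dim_vec v"]) (auto simp: sqnorm_def complex_norm_square simp del: of_real_power)

lemma l2_norm_sqnorm: "l2_norm v = sqrt (sqnorm v)"
  by (simp add: l2_norm_def cscalar_self)

lemma sqnorm_eq_0_iff:
  assumes "v \<in> carrier_vec n"
  shows "sqnorm v = 0 \<longleftrightarrow> v = 0\<^sub>v n"
  using assms by (auto simp: sqnorm_carrier sum_nonneg_eq_0_iff intro!: eq_vecI)

lemma unitary_matD:
  assumes "unitary_mat n U"
  shows "U \<in> carrier_mat n n" "mat_adjoint U \<in> carrier_mat n n"
    "mat_adjoint U * U = 1\<^sub>m n" "U * mat_adjoint U = 1\<^sub>m n" "dim_row U = n" "dim_col U = n"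
  using assms by (auto simp: unitary_mat_def)

lemma unitary_mat_adjoint: "unitary_mat n U \<Longrightarrow> unitary_mat n (mat_adjoint U)"
  by (auto simp: unitary_mat_def)

lemma unitary_cancel_vec:
  assumes "unitary_mat n U" "v \<in> carrier_vec n"
  shows "U *\<^sub>v (mat_adjoint U *\<^sub>v v) = v" "mat_adjoint U *\<^sub>v (U *\<^sub>v v) = v"
  using assms unitary_matD[OF assms(1)]
  by (auto simp flip: assoc_mult_mat_vec[of _ n n _ n])

lemma unitary_cancel_mat:
  assumes "unitary_mat n U" "B \<in> carrier_mat n p"
  shows "U * (mat_adjoint U * B) = B" "mat_adjoint U * (U * B) = B"
  using assms unitary_matD[OF assms(1)]
  by (auto simp flip: assoc_mult_mat[of _ n n _ n _ p])

text \<open>Side conditions about dimensions contain no variables beyond those of the equation, so that the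
simplifier can discharge them; with \<open>carrier_mat\<close> it would have to guess the inner dimensions.\<close>

lemma assoc_mult_mat_dim:
  "dim_col A = dim_row B \<Longrightarrow> dim_col B = dim_row C \<Longrightarrow> (A * B) * C = A * (B * C)"
  by (rule assoc_mult_mat[of _ "dim_row A" "dim_col A" _ "dim_col B" _ "dim_col C"]) auto

lemma assoc_mult_mat_vec_dim:
  "dim_col A = dim_row B \<Longrightarrow> dim_col B = dim_vec v \<Longrightarrow> (A * B) *\<^sub>v v = A *\<^sub>v (B *\<^sub>v v)"
  by (rule assoc_mult_mat_vec[of _ "dim_row A" "dim_col A" _ "dim_col B"]) auto

lemma mat_adjoint_mult_dim:
  "dim_col A = dim_row B \<Longrightarrow> mat_adjoint (A * B) = mat_adjoint B * mat_adjoint (A :: complex mat)"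
  by (rule mat_adjoint_mult[of _ "dim_row A" "dim_col A" _ "dim_col B"]) auto

lemma unitary_cancel_mat_dim:
  assumes "unitary_mat n U" "dim_row B = n"
  shows "U * (mat_adjoint U * B) = B" "mat_adjoint U * (U * B) = B"
  by (rule unitary_cancel_mat[OF assms(1), of _ "dim_col B"]; use assms(2) in auto)+

lemmas mat_assoc_simps = assoc_mult_mat_dim assoc_mult_mat_vec_dim mat_adjoint_mult_dim
  unitary_cancel_mat_dim unitary_matD(3,4)

lemma unitary_mat_mult:
  assumes U: "unitary_mat n U" and W: "unitary_mat n W"
  shows "unitary_mat n (U * W)"
proof -
  note u = unitary_matD[OF U] and w = unitary_matD[OF W]
  have "mat_adjoint W * mat_adjoint U * (U * W) = mat_adjoint W * (mat_adjoint U * (U * W))"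
    using u w by (intro assoc_mult_mat[of _ n n _ n _ n]) auto
  moreover have "U * W * (mat_adjoint W * mat_adjoint U) = U * (W * (mat_adjoint W * mat_adjoint U))"
    using u w by (intro assoc_mult_mat[of _ n n _ n _ n]) auto
  ultimately show ?thesis
    using u w by (auto simp: unitary_mat_def mat_adjoint_mult[of _ n n _ n]
        unitary_cancel_mat[OF U] unitary_cancel_mat[OF W])
qed

lemma unitary_cscalar:
  assumes "unitary_mat n U" "x \<in> carrier_vec n" "y \<in> carrier_vec n"
  shows "(U *\<^sub>v x) \<bullet>c (U *\<^sub>v y) = x \<bullet>c y"
  using assms unitary_matD[OF assms(1)]
  by (subst cscalar_adjoint[of _ n n]) (auto simp: unitary_cancel_vec)

lemma unitary_sqnorm:
  assumes "unitary_mat n U" "x \<in> carrier_vec n"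
  shows "sqnorm (U *\<^sub>v x) = sqnorm x"
  using unitary_cscalar[OF assms assms(2)] by (simp add: cscalar_self)

lemma unitary_adjoint_sqnorm:
  assumes "unitary_mat n U" "x \<in> carrier_vec n"
  shows "sqnorm (mat_adjoint U *\<^sub>v x) = sqnorm x"
  using unitary_sqnorm[OF unitary_mat_adjoint] assms by blast

lemma adjoint_mult_index:
  fixes A B :: "complex mat"
  assumes "A \<in> carrier_mat n p" "B \<in> carrier_mat n r" "i < p" "j < r"
  shows "(mat_adjoint A * B) $$ (i, j) = col B j \<bullet>c col A i"
  using assms
  by (subst mult_mat_index[of _ p n _ r]) (auto simp: cscalar_sum[of _ n] mult.commute intro!: sum.cong)

lemma adjoint_mult_vec_index:
  fixes Z :: "complex mat"
  assumes "Z \<in> carrier_mat n p" "v \<in> carrier_vec n" "j < p"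
  shows "(mat_adjoint Z *\<^sub>v v) $ j = v \<bullet>c col Z j"
proof -
  have "(mat_adjoint Z *\<^sub>v v) $ j = (\<Sum>i<n. mat_adjoint Z $$ (j, i) * v $ i)"
    using assms by (intro mult_mat_vec_index[of _ p n]) auto
  also have "\<dots> = (\<Sum>i<n. v $ i * cnj (col Z j $ i))"
    using assms by (intro sum.cong) auto
  also have "\<dots> = v \<bullet>c col Z j"
    using assms by (intro cscalar_sum[symmetric]) auto
  finally show ?thesis .
qed

lemma unitary_mat_iff_cols:
  assumes U: "U \<in> carrier_mat n n"
  shows "unitary_mat n U \<longleftrightarrow> (\<forall>i<n. \<forall>j<n. col U i \<bullet>c col U j = (if i = j then 1 else 0))"
    (is "_ \<longleftrightarrow> ?R")
proof
  assume un: "unitary_mat n U"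
  show ?R
  proof (intro allI impI)
    fix i j assume ij: "i < n" "j < n"
    have "col U i \<bullet>c col U j = (mat_adjoint U * U) $$ (j, i)"
      using adjoint_mult_index[OF U U, of j i] ij by simp
    then show "col U i \<bullet>c col U j = (if i = j then 1 else 0)"
      using ij by (simp add: unitary_matD(3)[OF un])
  qed
next
  assume R: ?R
  have "mat_adjoint U * U = 1\<^sub>m n"
  proof (rule eq_matI)
    fix i j assume "i < dim_row (1\<^sub>m n :: complex mat)" "j < dim_col (1\<^sub>m n :: complex mat)"
    then have "i < n" "j < n" by auto
    then show "(mat_adjoint U * U) $$ (i, j) = 1\<^sub>m n $$ (i, j)"
      using R by (subst adjoint_mult_index[OF U U]) auto
  qed (use U in auto)
  then show "unitary_mat n U"
    using U mat_mult_left_right_inverse[of "mat_adjoint U" n U] by (auto simp: unitary_mat_def)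
qed

lemma unitary_sqnorm_col:
  assumes "unitary_mat n U" "j < n"
  shows "sqnorm (col U j) = 1"
proof -
  have "col U j \<bullet>c col U j = 1"
    using assms unitary_mat_iff_cols[OF unitary_matD(1)[OF assms(1)]] by auto
  then show ?thesis by (simp add: cscalar_self)
qed

text \<open>A linear functional is identified with the row vector that represents it, and a subspace is given as
the set of common zeros of a list of functionals. Its codimension is then bounded by the length of
the list, and dimension counts amount to comparing lengths.\<close>

definition linear_functional :: "nat \<Rightarrow> (complex vec \<Rightarrow> complex) \<Rightarrow> bool" where
  "linear_functional n \<phi> \<longleftrightarrow> (\<exists>r \<in> carrier_vec n. \<forall>v \<in> carrier_vec n. \<phi> v = r \<bullet> v)"

text \<open>Fewer than \<open>n\<close> homogeneous equations in \<open>n\<close> unknowns have a nontrivial solution: padded with zero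
rows, the coefficient matrix is square and singular.\<close>

lemma common_zero_of_functionals:
  assumes \<phi>: "\<And>\<phi>. \<phi> \<in> set \<phi>s \<Longrightarrow> linear_functional n \<phi>" and len: "length \<phi>s < n"
  obtains v where "v \<in> carrier_vec n" "v \<noteq> 0\<^sub>v n" "\<And>\<phi>. \<phi> \<in> set \<phi>s \<Longrightarrow> \<phi> v = 0"
proof -
  have "\<forall>\<phi> \<in> set \<phi>s. \<exists>r. r \<in> carrier_vec n \<and> (\<forall>v \<in> carrier_vec n. \<phi> v = r \<bullet> v)"
    using \<phi> by (auto simp: linear_functional_def)
  then obtain r where r: "\<And>\<phi>. \<phi> \<in> set \<phi>s \<Longrightarrow> r \<phi> \<in> carrier_vec n"
    "\<And>\<phi> v. \<phi> \<in> set \<phi>s \<Longrightarrow> v \<in> carrier_vec n \<Longrightarrow> \<phi> v = r \<phi> \<bullet> v"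
    by metis
  define M where "M = mat n n (\<lambda>(i, j). if i < length \<phi>s then r (\<phi>s ! i) $ j else 0)"
  have M: "M \<in> carrier_mat n n"
    by (simp add: M_def)
  define last where "last = n - 1"
  have last: "last < n" "\<not> last < length \<phi>s"
    using len by (auto simp: last_def)
  have "M\<^sup>T *\<^sub>v unit_vec n last = 0\<^sub>v n"
    using M last by (intro eq_vecI) (auto simp: M_def scalar_prod_def intro!: sum.neutral)
  moreover have "unit_vec n last \<noteq> (0\<^sub>v n :: complex vec)"
    using last by (metis index_unit_vec(1) index_zero_vec(1) zero_neq_one)
  ultimately have "det (M\<^sup>T) = 0"
    using M det_0_iff_vec_prod_zero[of "M\<^sup>T" n] unit_vec_carrier[of n last]
      transpose_carrier_mat[THEN iffD2] by blast
  then have "\<exists>v. v \<in> carrier_vec n \<and> v \<noteq> 0\<^sub>v n \<and> M *\<^sub>v v = 0\<^sub>v n"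
    using det_0_iff_vec_prod_zero[OF M] det_transpose[OF M] by simp
  then obtain v where v: "v \<in> carrier_vec n" "v \<noteq> 0\<^sub>v n" "M *\<^sub>v v = 0\<^sub>v n"
    by blast
  have "\<phi> v = 0" if in_set: "\<phi> \<in> set \<phi>s" for \<phi>
  proof -
    obtain i where i: "i < length \<phi>s" "\<phi> = \<phi>s ! i"
      using in_set by (metis in_set_conv_nth)
    have "row M i = r \<phi>"
      using i len r(1)[OF in_set] by (auto simp: M_def row_def intro!: eq_vecI)
    then have "\<phi> v = (M *\<^sub>v v) $ i"
      using r(2)[OF in_set v(1)] i len M by auto
    then show ?thesis
      using v(3) i len by auto
  qed
  with v that show ?thesis by blast
qed

lemma linear_functional_diff:
  assumes "linear_functional n \<phi>" "linear_functional n \<psi>"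
  shows "linear_functional n (\<lambda>v. \<phi> v - \<psi> v)"
proof -
  obtain r s where "r \<in> carrier_vec n" "s \<in> carrier_vec n"
    "\<And>v. v \<in> carrier_vec n \<Longrightarrow> \<phi> v = r \<bullet> v" "\<And>v. v \<in> carrier_vec n \<Longrightarrow> \<psi> v = s \<bullet> v"
    using assms by (auto simp: linear_functional_def)
  then show ?thesis
    unfolding linear_functional_def
    by (intro bexI[of _ "r - s"]) (auto simp: minus_scalar_prod_distrib)
qed

lemma linear_functional_row:
  assumes "A \<in> carrier_mat m n" "i < m"
  shows "linear_functional n (\<lambda>v. (A *\<^sub>v v) $ i)"
  using assms unfolding linear_functional_def by (intro bexI[of _ "row A i"]) auto

lemma linear_functional_inner:
  assumes "u \<in> carrier_vec n"
  shows "linear_functional n (\<lambda>v. v \<bullet>c u)"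
  using assms unfolding linear_functional_def
  by (intro bexI[of _ "conjugate u"]) (auto intro: comm_scalar_prod)

lemma normalize_vec:
  fixes v :: "complex vec"
  assumes v: "v \<in> carrier_vec n" "v \<noteq> 0\<^sub>v n"
  obtains c where "c \<noteq> 0" "(c \<cdot>\<^sub>v v) \<bullet>c (c \<cdot>\<^sub>v v) = 1"
proof -
  define s where "s = sqrt (sqnorm v)"
  have s: "s > 0"
    using v sqnorm_eq_0_iff[OF v(1)] sqnorm_nonneg[of v] by (auto simp: s_def less_le)
  let ?c = "complex_of_real (1 / s)"
  have "(?c \<cdot>\<^sub>v v) \<bullet>c (?c \<cdot>\<^sub>v v) = complex_of_real (sqnorm (?c \<cdot>\<^sub>v v))"
    by (rule cscalar_self)
  also have "sqnorm (?c \<cdot>\<^sub>v v) = (1 / s)\<^sup>2 * sqnorm v"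
    using s by (simp add: sqnorm_def norm_mult power_mult_distrib sum_distrib_left norm_divide power_divide)
  also have "\<dots> = 1"
    using s sqnorm_nonneg[of v] by (simp add: s_def power_divide)
  finally show ?thesis
    using s by (intro that[of ?c]) auto
qed

text \<open>As long as there are fewer than \<open>n\<close> vectors, orthogonality to all of them is a system of fewer than \<open>n\<close>
equations, so another unit vector can be added.\<close>

lemma orthonormal_extension:
  fixes u :: "nat \<Rightarrow> complex vec"
  assumes "r \<le> n" "\<And>i. i < r \<Longrightarrow> u i \<in> carrier_vec n"
    "\<And>i j. i < r \<Longrightarrow> j < r \<Longrightarrow> u i \<bullet>c u j = (if i = j then 1 else 0)"
  obtains U where "unitary_mat n U" "\<And>i. i < r \<Longrightarrow> col U i = u i"
  using assms
proof (induction "n - r" arbitrary: r u thesis)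
  case 0
  then have r: "r = n" by simp
  define U where "U = mat_of_cols n (map u [0..<n])"
  have U: "U \<in> carrier_mat n n" and c: "\<And>i. i < n \<Longrightarrow> col U i = u i"
    using 0(4) by (auto simp: U_def r)
  have "unitary_mat n U"
    unfolding unitary_mat_iff_cols[OF U] using c 0(5) by (auto simp: r)
  with 0(2) c show ?case by (auto simp: r)
next
  case (Suc d)
  then have r: "r < n" by simp
  obtain v where v: "v \<in> carrier_vec n" "v \<noteq> 0\<^sub>v n" and
    ort: "\<And>\<phi>. \<phi> \<in> set (map (\<lambda>i v. v \<bullet>c u i) [0..<r]) \<Longrightarrow> \<phi> v = 0"
    by (rule common_zero_of_functionals[of "map (\<lambda>i v. v \<bullet>c u i) [0..<r]" n])
      (use r Suc.prems(3) in \<open>auto intro!: linear_functional_inner\<close>)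
  have vu: "v \<bullet>c u i = 0" if "i < r" for i
    using ort[of "\<lambda>v. v \<bullet>c u i"] that by auto
  have uv: "u i \<bullet>c v = 0" if "i < r" for i
    using vu[OF that] v(1) Suc.prems(3)[OF that]
    by (metis conjugate_complex_def complex_cnj_zero conjugate_conjugate_sprod conjugate_vec_sprod_comm)
  obtain c where c: "c \<noteq> 0" "(c \<cdot>\<^sub>v v) \<bullet>c (c \<cdot>\<^sub>v v) = 1"
    by (rule normalize_vec[OF v])
  define u' where "u' = (\<lambda>i. if i = r then c \<cdot>\<^sub>v v else u i)"
  have cv1: "u i \<bullet>c (c \<cdot>\<^sub>v v) = 0" "(c \<cdot>\<^sub>v v) \<bullet>c u i = 0" if "i < r" for i
    using vu[OF that] uv[OF that] v(1) Suc.prems(3)[OF that]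
    by (auto simp: conjugate_smult_vec)
  show ?case
  proof (rule Suc.hyps(1)[of "Suc r" u'])
    show "d = n - Suc r" "Suc r \<le> n" using Suc.hyps(2) by auto
    show "u' i \<in> carrier_vec n" if "i < Suc r" for i
      using that v Suc.prems(3) by (auto simp: u'_def less_Suc_eq)
    show "u' i \<bullet>c u' j = (if i = j then 1 else 0)" if "i < Suc r" "j < Suc r" for i j
      using that Suc.prems(4)[of i j] cv1 c(2) by (auto simp: u'_def less_Suc_eq)
    show thesis if "unitary_mat n U" "\<And>i. i < Suc r \<Longrightarrow> col U i = u' i" for U
      using that Suc.prems(1)[of U] by (auto simp: u'_def)
  qed
qed

section \<open>The spectral theorem for Hermitian matrices\<close>

text \<open>The block matrix with diagonal blocks \<open>a\<close> and \<open>M\<close>, used for the induction on the dimension.\<close>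

definition corner_extend :: "complex \<Rightarrow> complex mat \<Rightarrow> complex mat" where
  "corner_extend a M =
     four_block_mat (mat 1 1 (\<lambda>_. a)) (0\<^sub>m 1 (dim_col M)) (0\<^sub>m (dim_row M) 1) M"

lemma corner_extend_dim [simp]:
  "dim_row (corner_extend a M) = Suc (dim_row M)" "dim_col (corner_extend a M) = Suc (dim_col M)"
  by (auto simp: corner_extend_def)

lemma corner_extend_index:
  assumes "i < Suc (dim_row M)" "j < Suc (dim_col M)"
  shows "corner_extend a M $$ (i, j) =
    (if i = 0 \<and> j = 0 then a else if i = 0 \<or> j = 0 then 0 else M $$ (i - 1, j - 1))"
  using assms by (auto simp: corner_extend_def)

lemma corner_extend_mult:
  assumes "M \<in> carrier_mat n p" "N \<in> carrier_mat p r"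
  shows "corner_extend a M * corner_extend b N = corner_extend (a * b) (M * N)"
proof -
  have "mat 1 1 (\<lambda>_. a) * mat 1 1 (\<lambda>_. b) = mat 1 1 (\<lambda>_. a * b)"
    by (rule eq_matI) (auto simp: scalar_prod_def)
  then show ?thesis
    using assms unfolding corner_extend_def
    by (subst mult_four_block_mat[of _ 1 1 _ p _ n _ _ 1 _ r]) auto
qed

lemma corner_extend_adjoint: "mat_adjoint (corner_extend a M) = corner_extend (cnj a) (mat_adjoint M)"
  by (rule eq_matI) (auto simp: corner_extend_index)

lemma corner_extend_one: "corner_extend 1 (1\<^sub>m n) = 1\<^sub>m (Suc n)"
  by (rule eq_matI) (auto simp: corner_extend_index)

lemma corner_extend_unitary: "unitary_mat n Q \<Longrightarrow> unitary_mat (Suc n) (corner_extend 1 Q)"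
  unfolding unitary_mat_def
  by (auto simp: corner_extend_adjoint corner_extend_mult[of _ n n _ n] corner_extend_one
      intro!: carrier_matI)

lemma dim_mat_diag [simp]: "dim_row (mat_diag n d) = n" "dim_col (mat_diag n d) = n"
  by (auto simp: mat_diag_def)

lemma mat_diag_Suc:
  "mat_diag (Suc n) d = corner_extend (d 0) (mat_diag n (\<lambda>i. d (Suc i)))"
  by (rule eq_matI) (auto simp: corner_extend_index mat_diag_def)

lemma unit_eigenvector_exists:
  fixes A :: "complex mat"
  assumes A: "A \<in> carrier_mat n n" and "n > 0"
  obtains v l where "v \<in> carrier_vec n" "v \<bullet>c v = 1" "A *\<^sub>v v = l \<cdot>\<^sub>v v"
proof -
  have "degree (char_poly A) > 0"
    using degree_monic_char_poly[OF A] \<open>n > 0\<close> by simp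
  then obtain l where "poly (char_poly A) l = 0"
    using fundamental_theorem_of_algebra[of "char_poly A"] constant_degree by (metis not_gr_zero)
  then obtain v where v: "v \<in> carrier_vec n" "v \<noteq> 0\<^sub>v n" "A *\<^sub>v v = l \<cdot>\<^sub>v v"
    using eigenvalue_root_char_poly[OF A] A by (auto simp: eigenvalue_def eigenvector_def)
  obtain c where c: "c \<noteq> 0" "(c \<cdot>\<^sub>v v) \<bullet>c (c \<cdot>\<^sub>v v) = 1"
    by (rule normalize_vec[OF v(1,2)])
  have "A *\<^sub>v (c \<cdot>\<^sub>v v) = l \<cdot>\<^sub>v (c \<cdot>\<^sub>v v)"
    using v A by (simp add: mult_mat_vec[of A n n] smult_smult_assoc mult.commute)
  with v(1) that[OF _ c(2)] show ?thesis by simp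
qed

lemma conjugation_assoc:
  assumes "U \<in> carrier_mat n n" "K \<in> carrier_mat n n" "D \<in> carrier_mat n n"
    "K' \<in> carrier_mat n n" "U' \<in> carrier_mat n n"
  shows "(U * K) * D * (K' * U') = U * ((K * D * K') * U')"
proof -
  have "(U * K) * D = U * (K * D)"
    using assms by (intro assoc_mult_mat[of _ n n _ n _ n])
  then have "(U * K) * D * (K' * U') = U * ((K * D) * (K' * U'))"
    using assms by (simp add: assoc_mult_mat[of U n n "K * D" n "K' * U'" n])
  also have "(K * D) * (K' * U') = (K * D * K') * U'"
    using assms by (intro assoc_mult_mat[symmetric, of _ n n _ n _ n]) auto
  finally show ?thesis .
qed

text \<open>In an orthonormal basis whose first vector is an eigenvector, the first column of the matrix vanishes
below the diagonal. Being Hermitian, the matrix splits into a real \<open>1 \<times> 1\<close> block and a smaller Hermitian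
block, to which the induction hypothesis applies.\<close>

lemma spectral_theorem_unsorted:
  fixes A :: "complex mat"
  assumes "A \<in> carrier_mat n n" "mat_adjoint A = A"
  obtains Q \<mu> where "unitary_mat n Q"
    "A = Q * mat_diag n (\<lambda>i. complex_of_real (\<mu> i)) * mat_adjoint Q"
  using assms
proof (induction n arbitrary: A thesis)
  case 0
  show ?case
    by (rule 0(1)[of "1\<^sub>m 0"]) (use 0(2) in \<open>auto simp: unitary_mat_def intro!: eq_matI\<close>)
next
  case (Suc n)
  note A = \<open>A \<in> carrier_mat (Suc n) (Suc n)\<close>
  obtain v l where v: "v \<in> carrier_vec (Suc n)" "v \<bullet>c v = 1" "A *\<^sub>v v = l \<cdot>\<^sub>v v"
    by (rule unit_eigenvector_exists[OF A]) auto
  obtain U where U: "unitary_mat (Suc n) U" and U0: "col U 0 = v"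
    by (rule orthonormal_extension[of 1 "Suc n" "\<lambda>_. v"]) (use v in auto)
  note u = unitary_matD[OF U]
  define C where "C = mat_adjoint U * (A * U)"
  have C: "C \<in> carrier_mat (Suc n) (Suc n)"
    using u A by (auto simp: C_def)
  have Cadj: "mat_adjoint C = C"
  proof -
    have "mat_adjoint C = (mat_adjoint U * A) * U"
      using u A Suc.prems(3) unfolding C_def
      by (simp add: mat_adjoint_mult[of _ "Suc n" "Suc n" _ "Suc n"])
    then show ?thesis
      using u A by (simp add: C_def assoc_mult_mat[of _ "Suc n" "Suc n" _ "Suc n" _ "Suc n"])
  qed
  have C0: "C $$ (i, 0) = (if i = 0 then l else 0)" if "i < Suc n" for i
  proof -
    have "C $$ (i, 0) = col (A * U) 0 \<bullet>c col U i"
      unfolding C_def using u A that by (subst adjoint_mult_index[of _ "Suc n" "Suc n" _ "Suc n"]) auto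
    also have "col (A * U) 0 = l \<cdot>\<^sub>v v"
      using u A v U0 by (subst col_mult2[of _ "Suc n" "Suc n" _ "Suc n"]) auto
    also have "(l \<cdot>\<^sub>v v) \<bullet>c col U i = l * (col U 0 \<bullet>c col U i)"
      using v(1) u that by (simp add: U0)
    also have "\<dots> = (if i = 0 then l else 0)"
      using that U unfolding unitary_mat_iff_cols[OF u(1)] by auto
    finally show ?thesis .
  qed
  have C0': "C $$ (0, j) = cnj (C $$ (j, 0))" if "j < Suc n" for j
    using C that mat_adjoint_index[of 0 C j] by (simp add: Cadj)
  have l: "l = complex_of_real (Re l)"
    using C0[of 0] C0'[of 0] by (simp add: complex_eq_iff)
  define A' where "A' = mat n n (\<lambda>(i, j). C $$ (Suc i, Suc j))"
  have A': "A' \<in> carrier_mat n n"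
    by (simp add: A'_def)
  have CA': "C = corner_extend l A'"
    using C C0 C0' by (intro eq_matI) (auto simp: corner_extend_index A'_def)
  have "mat_adjoint A' = A'"
  proof (rule eq_matI)
    fix i j assume "i < dim_row A'" "j < dim_col A'"
    then show "mat_adjoint A' $$ (i, j) = A' $$ (i, j)"
      using C mat_adjoint_index[of "Suc i" C "Suc j"] by (simp add: Cadj A'_def)
  qed (auto simp: A'_def)
  then obtain Q \<mu> where Q: "unitary_mat n Q"
    and A'Q: "A' = Q * mat_diag n (\<lambda>i. complex_of_real (\<mu> i)) * mat_adjoint Q"
    using Suc.IH[OF _ A'] by blast
  note q = unitary_matD[OF Q]
  define \<mu>' where "\<mu>' = case_nat (Re l) \<mu>"
  define K where "K = corner_extend 1 Q"
  have K: "unitary_mat (Suc n) K"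
    unfolding K_def by (rule corner_extend_unitary[OF Q])
  note k = unitary_matD[OF K]
  let ?D = "mat_diag (Suc n) (\<lambda>i. complex_of_real (\<mu>' i))"
  have D: "?D \<in> carrier_mat (Suc n) (Suc n)" by simp
  have "K * ?D * mat_adjoint K = corner_extend l A'"
  proof -
    have "?D = corner_extend l (mat_diag n (\<lambda>i. complex_of_real (\<mu> i)))"
      unfolding mat_diag_Suc using l by (simp add: \<mu>'_def)
    then have "K * ?D = corner_extend l (Q * mat_diag n (\<lambda>i. complex_of_real (\<mu> i)))"
      using q by (simp add: K_def corner_extend_mult[of _ n n _ n])
    then show ?thesis
      using q by (simp add: K_def corner_extend_adjoint A'Q
          corner_extend_mult[of "Q * mat_diag n (\<lambda>i. complex_of_real (\<mu> i))" n n _ n])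
  qed
  then have "(U * K) * ?D * mat_adjoint (U * K) = U * (C * mat_adjoint U)"
    unfolding mat_adjoint_mult[OF u(1) k(1)] CA'
    by (subst conjugation_assoc[OF u(1) k(1) D k(2) u(2)]) simp
  also have "C * mat_adjoint U = mat_adjoint U * A"
    using u A unfolding C_def
    by (simp add: assoc_mult_mat[of _ "Suc n" "Suc n" _ "Suc n" _ "Suc n"])
  also have "U * (mat_adjoint U * A) = A"
    by (rule unitary_cancel_mat[OF U A])
  finally have "A = (U * K) * ?D * mat_adjoint (U * K)" by simp
  with unitary_mat_mult[OF U K] show ?case
    by (rule Suc.prems(1))
qed

text \<open>Allowing rectangular \<open>V\<close> and \<open>W\<close> here, and \<open>Q\<close> in the lemmas on quadratic forms and traces, covers both eigenvalue
decompositions and sums \<open>\<Sum> d\<^sub>j z\<^sub>j z\<^sub>j\<^sup>*\<close> of rank-one matrices, where the \<open>z\<^sub>j\<close> are the columns.\<close>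

lemma diag_conjugation_index:
  assumes "V \<in> carrier_mat n p" "W \<in> carrier_mat r p" "i < n" "l < r"
  shows "(V * mat_diag p d * mat_adjoint W) $$ (i, l) = (\<Sum>j<p. V $$ (i, j) * d j * cnj (W $$ (l, j)))"
proof -
  have "V * mat_diag p d \<in> carrier_mat n p"
    using assms(1) by simp
  then show ?thesis
    using assms by (subst mult_mat_index[of _ n p _ r]) (auto simp: mat_diag_mult_right[of _ n p])
qed

text \<open>Permuting the columns of the unitary matrix sorts the eigenvalues.\<close>

theorem spectral_theorem:
  fixes A :: "complex mat"
  assumes A: "A \<in> carrier_mat n n" "mat_adjoint A = A"
  obtains Q \<mu> where "unitary_mat n Q"
    "A = Q * mat_diag n (\<lambda>i. complex_of_real (\<mu> i)) * mat_adjoint Q"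
    "\<And>i j. i \<le> j \<Longrightarrow> j < n \<Longrightarrow> \<mu> j \<le> \<mu> i"
proof -
  obtain Q \<mu> where Q: "unitary_mat n Q"
    and AQ: "A = Q * mat_diag n (\<lambda>i. complex_of_real (\<mu> i)) * mat_adjoint Q"
    by (rule spectral_theorem_unsorted[OF A])
  note q = unitary_matD[OF Q]
  let ?xs = "map \<mu> [0..<n]"
  obtain p where p: "p permutes {..<n}" "permute_list p ?xs = rev (sort ?xs)"
    using mset_eq_permutation[of "rev (sort ?xs)" ?xs] by auto
  have p_less: "p i < n" if "i < n" for i
    using permutes_in_image[OF p(1), of i] that by simp
  have nth: "\<mu> (p i) = rev (sort ?xs) ! i" if "i < n" for i
    using that p_less[OF that] by (simp flip: p(2) add: permute_list_nth p(1))
  define R where "R = mat n n (\<lambda>(i, j). Q $$ (i, p j))"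
  have R: "R \<in> carrier_mat n n" by (simp add: R_def)
  have colR: "col R j = col Q (p j)" if "j < n" for j
    using that p_less[OF that] q by (intro eq_vecI) (auto simp: R_def)
  have "unitary_mat n R"
    using Q p_less permutes_inj[OF p(1)]
    by (simp add: unitary_mat_iff_cols[OF R] unitary_mat_iff_cols[OF q(1)] colR inj_eq)
  moreover have "A = R * mat_diag n (\<lambda>i. complex_of_real (\<mu> (p i))) * mat_adjoint R"
  proof (rule eq_matI)
    fix i l
    assume "i < dim_row (R * mat_diag n (\<lambda>i. complex_of_real (\<mu> (p i))) * mat_adjoint R)"
      "l < dim_col (R * mat_diag n (\<lambda>i. complex_of_real (\<mu> (p i))) * mat_adjoint R)"
    then have il: "i < n" "l < n" by (auto simp: R_def)
    have "A $$ (i, l) = (\<Sum>j<n. Q $$ (i, j) * complex_of_real (\<mu> j) * cnj (Q $$ (l, j)))"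
      unfolding AQ by (rule diag_conjugation_index[OF q(1) q(1) il])
    also have "\<dots> = (\<Sum>j<n. Q $$ (i, p j) * complex_of_real (\<mu> (p j)) * cnj (Q $$ (l, p j)))"
      using sum.permute[OF p(1)] by (simp add: comp_def)
    also have "\<dots> = (R * mat_diag n (\<lambda>i. complex_of_real (\<mu> (p i))) * mat_adjoint R) $$ (i, l)"
      using il by (subst diag_conjugation_index[OF R R il]) (auto simp: R_def)
    finally show "A $$ (i, l) = (R * mat_diag n (\<lambda>i. complex_of_real (\<mu> (p i))) * mat_adjoint R) $$ (i, l)" .
  qed (use A R in auto)
  moreover have "\<mu> (p j) \<le> \<mu> (p i)" if "i \<le> j" "j < n" for i j
    using that by (simp add: nth rev_nth sorted_nth_mono)
  ultimately show ?thesis by (rule that)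
qed

lemma quadratic_form_diag:
  assumes Q: "Q \<in> carrier_mat n p" and v: "v \<in> carrier_vec n"
  shows "((Q * mat_diag p (\<lambda>i. complex_of_real (d i)) * mat_adjoint Q) *\<^sub>v v) \<bullet>c v =
    complex_of_real (\<Sum>i<p. d i * (cmod ((mat_adjoint Q *\<^sub>v v) $ i))\<^sup>2)"
proof -
  let ?D = "mat_diag p (\<lambda>i. complex_of_real (d i))" and ?z = "mat_adjoint Q *\<^sub>v v"
  have z: "?z \<in> carrier_vec p" using Q by simp
  have "(Q * ?D * mat_adjoint Q) *\<^sub>v v = (Q * ?D) *\<^sub>v ?z"
    using Q v by (intro assoc_mult_mat_vec[of _ n p _ n]) auto
  also have "\<dots> = Q *\<^sub>v (?D *\<^sub>v ?z)"
    using Q z by (intro assoc_mult_mat_vec[of _ n p _ p]) auto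
  finally have "((Q * ?D * mat_adjoint Q) *\<^sub>v v) \<bullet>c v = (?D *\<^sub>v ?z) \<bullet>c ?z"
    using Q v z by (simp add: cscalar_adjoint[OF Q])
  also have "\<dots> = (\<Sum>i<p. (complex_of_real (d i) * ?z $ i) * cnj (?z $ i))"
  proof -
    have "(?D *\<^sub>v ?z) $ i = complex_of_real (d i) * ?z $ i" if "i < p" for i
      using that z by (subst mult_mat_vec_index[of _ p p])
        (auto simp: mat_diag_def if_distrib if_distribR cong: if_cong)
    then show ?thesis
      using z by (subst cscalar_sum[of _ p]) auto
  qed
  also have "\<dots> = complex_of_real (\<Sum>i<p. d i * (cmod (?z $ i))\<^sup>2)"
    by (simp add: mult.assoc complex_norm_square[symmetric])
  finally show ?thesis .
qed

lemma mat_adjoint_diag: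
  assumes Q: "Q \<in> carrier_mat n p"
  shows "mat_adjoint (Q * mat_diag p (\<lambda>i. complex_of_real (d i)) * mat_adjoint Q) =
    Q * mat_diag p (\<lambda>i. complex_of_real (d i)) * mat_adjoint Q" (is "mat_adjoint ?P = _")
proof (rule eq_matI)
  fix i j assume "i < dim_row ?P" "j < dim_col ?P"
  then have ij: "i < n" "j < n" using Q by auto
  then have "mat_adjoint ?P $$ (i, j) = cnj (?P $$ (j, i))"
    using Q by (intro mat_adjoint_index) auto
  also have "\<dots> = ?P $$ (i, j)"
    unfolding diag_conjugation_index[OF Q Q ij] diag_conjugation_index[OF Q Q ij(2) ij(1)]
    by (simp add: mult_ac)
  finally show "mat_adjoint ?P $$ (i, j) = ?P $$ (i, j)" .
qed (use Q in auto)

lemma trace_diag: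
  assumes Q: "Q \<in> carrier_mat n p"
  shows "(\<Sum>i<n. (Q * mat_diag p (\<lambda>i. complex_of_real (d i)) * mat_adjoint Q) $$ (i, i)) =
    complex_of_real (\<Sum>j<p. d j * sqnorm (col Q j))"
proof -
  have "(\<Sum>i<n. (Q * mat_diag p (\<lambda>i. complex_of_real (d i)) * mat_adjoint Q) $$ (i, i)) =
      (\<Sum>i<n. \<Sum>j<p. Q $$ (i, j) * complex_of_real (d j) * cnj (Q $$ (i, j)))"
    by (intro sum.cong refl diag_conjugation_index[OF Q Q]) auto
  also have "\<dots> = (\<Sum>j<p. \<Sum>i<n. Q $$ (i, j) * complex_of_real (d j) * cnj (Q $$ (i, j)))"
    by (rule sum.swap)
  also have "\<dots> = (\<Sum>j<p. complex_of_real (d j * sqnorm (col Q j)))"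
  proof (rule sum.cong[OF refl])
    fix j assume "j \<in> {..<p}"
    then show "(\<Sum>i<n. Q $$ (i, j) * complex_of_real (d j) * cnj (Q $$ (i, j))) =
        complex_of_real (d j * sqnorm (col Q j))"
      using Q by (simp add: sqnorm_carrier[of _ n] sum_distrib_left complex_norm_square mult_ac del: of_real_power)
  qed
  finally show ?thesis by simp
qed

section \<open>Singular value decompositions\<close>

definition rect_diag :: "nat \<Rightarrow> nat \<Rightarrow> (nat \<Rightarrow> real) \<Rightarrow> complex mat" where
  "rect_diag m n \<delta> = mat m n (\<lambda>(i, j). if i = j then complex_of_real (\<delta> i) else 0)"

lemma rect_diag_carrier [simp]: "rect_diag m n \<delta> \<in> carrier_mat m n"
  by (simp add: rect_diag_def)

lemma rect_diag_dim [simp]: "dim_row (rect_diag m n \<delta>) = m" "dim_col (rect_diag m n \<delta>) = n"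
  by (simp_all add: rect_diag_def)

lemma rect_diag_index [simp]:
  "i < m \<Longrightarrow> j < n \<Longrightarrow> rect_diag m n \<delta> $$ (i, j) = (if i = j then complex_of_real (\<delta> i) else 0)"
  by (simp add: rect_diag_def)

lemma rect_diag_mult_vec_index:
  assumes "z \<in> carrier_vec n" "i < m"
  shows "(rect_diag m n \<delta> *\<^sub>v z) $ i = (if i < n then complex_of_real (\<delta> i) * z $ i else 0)"
proof -
  have "(rect_diag m n \<delta> *\<^sub>v z) $ i = (\<Sum>j<n. rect_diag m n \<delta> $$ (i, j) * z $ j)"
    by (rule mult_mat_vec_index[OF rect_diag_carrier assms])
  also have "\<dots> = (\<Sum>j<n. if j = i then complex_of_real (\<delta> i) * z $ i else 0)"
    using assms by (intro sum.cong) auto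
  finally show ?thesis by simp
qed

text \<open>Let the columns of \<open>W\<close> be eigenvectors of \<open>A\<^sup>*A\<close> for the eigenvalues \<open>\<sigma>\<^sub>i\<^sup>2\<close>. The columns of \<open>A W\<close> are orthogonal of
norm \<open>\<sigma>\<^sub>i\<close>. Normalizing the nonzero ones gives an orthonormal family, which is extended to the columns of \<open>V\<close>.\<close>

theorem full_svd_exists:
  fixes A :: "complex mat"
  assumes A: "A \<in> carrier_mat m n"
  obtains V W \<sigma> where "unitary_mat m V" "unitary_mat n W"
    "A = V * rect_diag m n \<sigma> * mat_adjoint W"
    "\<And>i. 0 \<le> \<sigma> i" "\<And>i j. i \<le> j \<Longrightarrow> \<sigma> j \<le> \<sigma> i" "\<And>i. min m n \<le> i \<Longrightarrow> \<sigma> i = 0"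
proof -
  let ?G = "mat_adjoint A * A"
  have G: "?G \<in> carrier_mat n n" using A by auto
  have "mat_adjoint ?G = ?G"
    using A by (subst mat_adjoint_mult[of _ n m _ n]) auto
  then obtain W \<alpha> where W: "unitary_mat n W"
    and GW: "?G = W * mat_diag n (\<lambda>i. complex_of_real (\<alpha> i)) * mat_adjoint W"
    and anti: "\<And>i j. i \<le> j \<Longrightarrow> j < n \<Longrightarrow> \<alpha> j \<le> \<alpha> i"
    using spectral_theorem[OF G] by blast
  note w = unitary_matD[OF W]
  let ?D = "mat_diag n (\<lambda>i. complex_of_real (\<alpha> i))"
  define B where "B = A * W"
  have B: "B \<in> carrier_mat m n" using A w by (auto simp: B_def)
  have BB: "mat_adjoint B * B = ?D"
  proof -
    have "mat_adjoint B * B = mat_adjoint W * (?G * W)"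
      using A w by (simp add: B_def mat_assoc_simps)
    also have "\<dots> = ?D"
      using w W unfolding GW by (simp add: mat_assoc_simps)
    finally show ?thesis .
  qed
  have ortB: "col B i \<bullet>c col B j = (if i = j then complex_of_real (\<alpha> i) else 0)" if "i < n" "j < n" for i j
    using adjoint_mult_index[OF B B, of j i] that unfolding BB by (auto simp: mat_diag_def)
  have sqB: "sqnorm (col B i) = \<alpha> i" if "i < n" for i
    using ortB[OF that that] cscalar_self[of "col B i"] by simp
  have \<alpha>0: "0 \<le> \<alpha> i" if "i < n" for i
    using sqnorm_nonneg[of "col B i"] sqB[OF that] by simp
  \<comment> \<open>The eigenvalues are decreasing, so the positive ones are those with index below \<open>r\<close>.\<close>
  define r where "r = (LEAST i. i = n \<or> \<not> \<alpha> i > 0)"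
  have rn: "r \<le> n"
    unfolding r_def by (rule Least_le) simp
  have pos: "\<alpha> i > 0" if "i < r" for i
    using not_less_Least[of i "\<lambda>i. i = n \<or> \<not> \<alpha> i > 0"] that by (auto simp: r_def)
  have zero: "\<alpha> i = 0" if "r \<le> i" "i < n" for i
  proof -
    have "r = n \<or> \<not> \<alpha> r > 0"
      unfolding r_def by (rule LeastI[of _ n]) simp
    then show ?thesis
      using anti[of r i] \<alpha>0[of i] that by auto
  qed
  have rm: "r \<le> m"
  proof (rule ccontr)
    assume "\<not> r \<le> m"
    \<comment> \<open>Then some nonzero combination of the first \<open>r\<close> eigenvectors lies in the kernel of \<open>A\<close>.\<close>
    let ?\<phi>s = "map (\<lambda>i v. (A *\<^sub>v v) $ i) [0..<m] @ map (\<lambda>i v. (mat_adjoint W *\<^sub>v v) $ i) [r..<n]"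
    have functionals: "\<And>\<phi>. \<phi> \<in> set ?\<phi>s \<Longrightarrow> linear_functional n \<phi>"
      using A w by (auto simp del: index_mult_mat_vec intro: linear_functional_row[of _ m] linear_functional_row[of _ n])
    have "length ?\<phi>s < n" using \<open>\<not> r \<le> m\<close> rn by auto
    from common_zero_of_functionals[OF functionals this]
    obtain v where v: "v \<in> carrier_vec n" "v \<noteq> 0\<^sub>v n" and ann: "\<And>\<phi>. \<phi> \<in> set ?\<phi>s \<Longrightarrow> \<phi> v = 0"
      by blast
    let ?z = "mat_adjoint W *\<^sub>v v"
    have Av: "A *\<^sub>v v = 0\<^sub>v m"
    proof (rule eq_vecI)
      fix i assume "i < dim_vec (0\<^sub>v m :: complex vec)"
      then show "(A *\<^sub>v v) $ i = 0\<^sub>v m $ i"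
        using ann[of "\<lambda>v. (A *\<^sub>v v) $ i"] by simp
    qed (use A in auto)
    have z: "?z $ i = 0" if "r \<le> i" "i < n" for i
      using ann[of "\<lambda>v. (mat_adjoint W *\<^sub>v v) $ i"] that by simp
    have "?G *\<^sub>v v = 0\<^sub>v n"
      using A v Av by (subst assoc_mult_mat_vec[of _ n m]) (auto intro!: eq_vecI)
    then have "complex_of_real (\<Sum>i<n. \<alpha> i * (cmod (?z $ i))\<^sup>2) = 0"
      using quadratic_form_diag[OF w(1) v(1), of \<alpha>] v(1) by (simp flip: GW)
    then have sum0: "(\<Sum>i<n. \<alpha> i * (cmod (?z $ i))\<^sup>2) = 0"
      by (simp only: of_real_eq_0_iff)
    have "\<forall>i\<in>{..<n}. \<alpha> i * (cmod (?z $ i))\<^sup>2 = 0"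
      using sum0 \<alpha>0 by (subst (asm) sum_nonneg_eq_0_iff) auto
    then have "?z $ i = 0" if "i < n" for i
      using that pos[of i] z[of i] by (cases "i < r") force+
    then have "?z = 0\<^sub>v n"
      using w by (intro eq_vecI) auto
    then have "v = W *\<^sub>v 0\<^sub>v n"
      using unitary_cancel_vec(1)[OF W v(1)] by simp
    then show False
      using v(2) w by (auto intro!: eq_vecI)
  qed
  define \<sigma> where "\<sigma> i = (if i < n then sqrt (\<alpha> i) else 0)" for i
  define u where "u i = complex_of_real (1 / \<sigma> i) \<cdot>\<^sub>v col B i" for i
  have \<sigma>pos: "\<sigma> i > 0" "(\<sigma> i)\<^sup>2 = \<alpha> i" if "i < r" for i
    using that pos[OF that] rn by (auto simp: \<sigma>_def)
  have u_carrier: "u i \<in> carrier_vec m" if "i < r" for i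
    using B that rn by (auto simp: u_def)
  have u_orth: "u i \<bullet>c u j = (if i = j then 1 else 0)" if "i < r" "j < r" for i j
  proof -
    have "u i \<bullet>c u j = complex_of_real (1 / \<sigma> i) * (complex_of_real (1 / \<sigma> j) * (col B i \<bullet>c col B j))"
      using B that rn by (simp add: u_def conjugate_smult_vec)
    then show ?thesis
      using that rn ortB[of i j] \<sigma>pos[OF that(1)] by (auto simp: power2_eq_square simp flip: of_real_mult)
  qed
  obtain V where V: "unitary_mat m V" and Vu: "\<And>i. i < r \<Longrightarrow> col V i = u i"
    using orthonormal_extension[OF rm u_carrier u_orth] by blast
  note vv = unitary_matD[OF V]
  have "B = V * rect_diag m n \<sigma>"
  proof (rule eq_matI)
    fix i j assume "i < dim_row (V * rect_diag m n \<sigma>)" "j < dim_col (V * rect_diag m n \<sigma>)"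
    then have ij: "i < m" "j < n" using vv by auto
    have "(V * rect_diag m n \<sigma>) $$ (i, j) = (\<Sum>l<m. V $$ (i, l) * rect_diag m n \<sigma> $$ (l, j))"
      using ij vv by (intro mult_mat_index[of _ m m _ n]) auto
    also have "\<dots> = (\<Sum>l<m. if l = j then V $$ (i, j) * complex_of_real (\<sigma> j) else 0)"
      using ij by (intro sum.cong) auto
    also have "\<dots> = (if j < m then V $$ (i, j) * complex_of_real (\<sigma> j) else 0)"
      by simp
    also have "\<dots> = B $$ (i, j)"
    proof (cases "j < r")
      case True
      have "V $$ (i, j) = u j $ i"
        using Vu[OF True] True rm ij vv by (metis index_col order_less_le_trans)
      also have "\<dots> = complex_of_real (1 / \<sigma> j) * B $$ (i, j)"
        using B ij by (simp add: u_def)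
      finally show ?thesis
        using True rm \<sigma>pos(1)[OF True] by simp
    next
      case False
      then have "col B j = 0\<^sub>v m"
        using sqB[of j] zero[of j] ij B sqnorm_eq_0_iff[of "col B j" m] by auto
      then have "B $$ (i, j) = 0"
        using B ij by (metis carrier_matD index_col index_zero_vec(1))
      then show ?thesis
        using False zero[of j] ij by (simp add: \<sigma>_def)
    qed
    finally show "B $$ (i, j) = (V * rect_diag m n \<sigma>) $$ (i, j)" by simp
  qed (use B vv in auto)
  then have "A = V * rect_diag m n \<sigma> * mat_adjoint W"
  proof -
    have "B * mat_adjoint W = A"
      using A w unfolding B_def by simp
    then show ?thesis
      using \<open>B = V * rect_diag m n \<sigma>\<close> by simp
  qed
  then show ?thesis
  proof (rule that[OF V W])
    show "0 \<le> \<sigma> i" for i using \<alpha>0 by (auto simp: \<sigma>_def)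
    show "\<sigma> j \<le> \<sigma> i" if "i \<le> j" for i j using that anti \<alpha>0 by (auto simp: \<sigma>_def)
    show "\<sigma> i = 0" if "min m n \<le> i" for i
      using that rm zero[of i] by (auto simp: \<sigma>_def min_def split: if_splits)
  qed
qed

text \<open>This is what makes the positive semidefinite square root unique. The vector \<open>u = P v - \<rho> v\<close> satisfies
\<open>P u = - \<rho> u\<close>, which is impossible for \<open>\<rho> > 0\<close> unless \<open>u = 0\<close>; for \<open>\<rho> = 0\<close> use \<open>\<parallel>P v\<parallel>\<^sup>2 = \<langle>v, P\<^sup>2 v\<rangle> = 0\<close>.\<close>

lemma psd_sqrt_eigenvector:
  assumes P: "P \<in> carrier_mat n n" "psd_mat P" and v: "v \<in> carrier_vec n"
    and eig: "(P * P) *\<^sub>v v = complex_of_real (\<rho>\<^sup>2) \<cdot>\<^sub>v v" and "0 \<le> \<rho>"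
  shows "P *\<^sub>v v = complex_of_real \<rho> \<cdot>\<^sub>v v"
proof -
  have Padj: "mat_adjoint P = P" and Ppos: "\<And>x. x \<in> carrier_vec n \<Longrightarrow> 0 \<le> Re ((P *\<^sub>v x) \<bullet>c x)"
    using P by (auto simp: psd_mat_def)
  define u where "u = P *\<^sub>v v - complex_of_real \<rho> \<cdot>\<^sub>v v"
  have u: "u \<in> carrier_vec n" using P v by (auto simp: u_def)
  have PP: "P *\<^sub>v (P *\<^sub>v v) = complex_of_real (\<rho>\<^sup>2) \<cdot>\<^sub>v v"
    using eig P v by (simp add: assoc_mult_mat_vec[of P n n P n])
  have "u = 0\<^sub>v n"
  proof (cases "\<rho> = 0")
    case True
    have "(P *\<^sub>v v) \<bullet>c (P *\<^sub>v v) = v \<bullet>c (mat_adjoint P *\<^sub>v (P *\<^sub>v v))"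
      using P v by (intro cscalar_adjoint) auto
    also have "\<dots> = 0"
      using True v by (simp add: Padj PP cscalar_sum[of _ n])
    finally have "sqnorm (P *\<^sub>v v) = 0" by (simp add: cscalar_self)
    then have "P *\<^sub>v v = 0\<^sub>v n" using P v by (subst (asm) sqnorm_eq_0_iff[of _ n]) auto
    then show ?thesis using True v by (auto simp: u_def intro!: eq_vecI)
  next
    case False
    have "P *\<^sub>v u = complex_of_real (\<rho>\<^sup>2) \<cdot>\<^sub>v v - complex_of_real \<rho> \<cdot>\<^sub>v (P *\<^sub>v v)"
      using P v by (simp add: u_def PP mult_minus_distrib_mat_vec[of _ n n] mult_mat_vec[of _ n n])
    also have "\<dots> = complex_of_real (- \<rho>) \<cdot>\<^sub>v u"
      using P v by (intro eq_vecI) (auto simp: u_def algebra_simps power2_eq_square simp del: index_mult_mat_vec)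
    finally have "(P *\<^sub>v u) \<bullet>c u = complex_of_real (- \<rho>) * complex_of_real (sqnorm u)"
      using u by (simp add: cscalar_self)
    then have "Re ((P *\<^sub>v u) \<bullet>c u) = - \<rho> * sqnorm u"
      by simp
    then have "0 \<le> - \<rho> * sqnorm u" using Ppos[OF u] by simp
    then have "sqnorm u = 0"
      using False \<open>0 \<le> \<rho>\<close> sqnorm_nonneg[of u] by (simp add: mult_le_0_iff)
    then show ?thesis using u by (subst (asm) sqnorm_eq_0_iff) auto
  qed
  then show ?thesis
  proof -
    have "P *\<^sub>v v = u + complex_of_real \<rho> \<cdot>\<^sub>v v"
      using P v by (intro eq_vecI) (auto simp: u_def simp del: index_mult_mat_vec)
    then show ?thesis using \<open>u = 0\<^sub>v n\<close> v by simp
  qed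
qed

lemma psd_sqrt_diag:
  assumes Q: "unitary_mat n Q" and \<rho>: "\<And>i. 0 \<le> \<rho> i"
  shows "psd_sqrt (Q * mat_diag n (\<lambda>i. complex_of_real ((\<rho> i)\<^sup>2)) * mat_adjoint Q) =
    Q * mat_diag n (\<lambda>i. complex_of_real (\<rho> i)) * mat_adjoint Q"
proof -
  note q = unitary_matD[OF Q]
  let ?D = "mat_diag n (\<lambda>i. complex_of_real (\<rho> i))"
  let ?D2 = "mat_diag n (\<lambda>i. complex_of_real ((\<rho> i)\<^sup>2))"
  let ?P = "Q * ?D * mat_adjoint Q" and ?A = "Q * ?D2 * mat_adjoint Q"
  have P: "?P \<in> carrier_mat n n" using q by auto
  have adj: "mat_adjoint ?P = ?P"
    by (rule mat_adjoint_diag[OF q(1)])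
  have psd: "psd_mat ?P"
    unfolding psd_mat_def
  proof (intro conjI ballI)
    show "square_mat ?P" using q by simp
    show "0 \<le> Re ((?P *\<^sub>v v) \<bullet>c v)" if "v \<in> carrier_vec (dim_row ?P)" for v
    proof -
      have "v \<in> carrier_vec n" using that q by simp
      then show ?thesis
        unfolding quadratic_form_diag[OF q(1) \<open>v \<in> carrier_vec n\<close>] using \<rho> by (auto intro!: sum_nonneg)
    qed
  qed (rule adj)
  have sq: "?P * ?P = ?A"
  proof -
    have "?D * (?D * mat_adjoint Q) = ?D2 * mat_adjoint Q"
      using q by (subst assoc_mult_mat_dim[symmetric]) (auto simp: power2_eq_square)
    then show ?thesis
      using q Q by (simp add: mat_assoc_simps)
  qed
  have uniq: "P' = ?P" if P': "psd_mat P' \<and> P' * P' = ?A" for P'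
  proof -
    have c: "P' \<in> carrier_mat n n"
    proof -
      have "dim_row (P' * P') = n"
        using arg_cong[OF conjunct2[OF P'], of dim_row] q by (simp only: index_mult_mat)
      then have "dim_row P' = n" by simp
      moreover have "dim_col P' = dim_row P'" using P' by (simp add: psd_mat_def)
      ultimately show ?thesis by (intro carrier_matI) simp_all
    qed
    have "P' * Q = Q * ?D"
    proof (rule mat_col_eqI)
      fix i assume "i < dim_col (Q * ?D)"
      then have i: "i < n" by simp
      have AQ: "?A * Q = Q * ?D2"
        using q by (simp add: assoc_mult_mat_dim)
      have colD: "col (Q * mat_diag n d) i = d i \<cdot>\<^sub>v col Q i" for d
        using i q by (intro eq_vecI) (auto simp: mat_diag_mult_right[of _ n n] mult.commute)
      have "(P' * P') *\<^sub>v col Q i = col (?A * Q) i"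
        using P' i q c by (subst col_mult2[of _ n n _ n]) auto
      also have "\<dots> = complex_of_real ((\<rho> i)\<^sup>2) \<cdot>\<^sub>v col Q i"
        unfolding AQ colD ..
      finally have eig: "(P' * P') *\<^sub>v col Q i = complex_of_real ((\<rho> i)\<^sup>2) \<cdot>\<^sub>v col Q i" .
      have "col Q i \<in> carrier_vec n" using q i by auto
      from psd_sqrt_eigenvector[OF c conjunct1[OF P'] this eig \<rho>]
      have "P' *\<^sub>v col Q i = complex_of_real (\<rho> i) \<cdot>\<^sub>v col Q i" .
      then show "col (P' * Q) i = col (Q * ?D) i"
        unfolding colD using c q i by (subst col_mult2[of _ n n _ n]) auto
    qed (use c q in auto)
    then have "P' * Q * mat_adjoint Q = ?P" by simp
    then show ?thesis using c q by (simp add: assoc_mult_mat_dim)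
  qed
  show ?thesis
    unfolding psd_sqrt_def using psd sq uniq by (intro the_equality) blast+
qed

lemma eigenvalues_desc_diag:
  assumes Q: "unitary_mat n Q"
  shows "eigenvalues_desc (Q * mat_diag n (\<lambda>i. complex_of_real (d i)) * mat_adjoint Q) =
    rev (sort (map d [0..<n]))"
proof -
  note q = unitary_matD[OF Q]
  let ?D = "mat_diag n (\<lambda>i. complex_of_real (d i))"
  let ?A = "Q * ?D * mat_adjoint Q"
  have "similar_mat_wit ?A ?D Q (mat_adjoint Q)"
    using q by (intro similar_mat_witI[of _ _ n]) auto
  then have "char_poly ?A = char_poly ?D"
    by (intro char_poly_similar) (auto simp: similar_mat_def)
  also have "\<dots> = (\<Prod>a\<leftarrow>diag_mat ?D. [:- a, 1:])"
    by (rule char_poly_upper_triangular[of _ n]) (auto simp: mat_diag_def)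
  also have "diag_mat ?D = map (\<lambda>i. complex_of_real (d i)) [0..<n]"
    by (auto simp: diag_mat_def mat_diag_def)
  finally have cp: "char_poly ?A = (\<Prod>i\<leftarrow>[0..<n]. [:- complex_of_real (d i), 1:])"
    by (simp add: comp_def)
  have "proots (char_poly ?A) = (\<Sum>i\<leftarrow>[0..<n]. {#complex_of_real (d i)#})"
  proof -
    have "0 \<notin> set (map (\<lambda>i. [:- complex_of_real (d i), 1:]) [0..<n])" by auto
    from proots_prod_list[OF this] show ?thesis by (simp add: cp comp_def)
  qed
  also have "\<dots> = mset (map (\<lambda>i. complex_of_real (d i)) [0..<n])"
    by (simp add: sum_list_singleton_mset)
  finally have "image_mset Re (proots (char_poly ?A)) = mset (map d [0..<n])"
    by (simp add: image_mset.compositionality comp_def)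
  then show ?thesis
    unfolding eigenvalues_desc_def
    by (metis sorted_list_of_multiset_mset)
qed

text \<open>The diagonal entries may be unsorted and of any sign; this generality is needed for \<open>F - U\<close>. The square
root of \<open>A\<^sup>*A\<close> has the eigenvalues \<open>\<bar>\<delta>\<^sub>i\<bar>\<close> for \<open>i < min m n\<close> and further zeros, and since the list is
decreasing, the extra zeros come last.\<close>

theorem singular_values_of_rect_diag:
  assumes V: "unitary_mat m V" and W: "unitary_mat n W"
    and AV: "A = V * rect_diag m n \<delta> * mat_adjoint W"
  shows "map (singular_value A) [0..<min m n] = rev (sort (map (\<lambda>i. \<bar>\<delta> i\<bar>) [0..<min m n]))"
proof -
  note v = unitary_matD[OF V] and w = unitary_matD[OF W]
  let ?R = "rect_diag m n \<delta>" and ?q = "min m n"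
  define \<rho> where "\<rho> i = (if i < m then \<bar>\<delta> i\<bar> else 0)" for i
  have RR: "mat_adjoint ?R * ?R = mat_diag n (\<lambda>i. complex_of_real ((\<rho> i)\<^sup>2))"
  proof (rule eq_matI)
    fix i j assume "i < dim_row (mat_diag n (\<lambda>i. complex_of_real ((\<rho> i)\<^sup>2)))"
      "j < dim_col (mat_diag n (\<lambda>i. complex_of_real ((\<rho> i)\<^sup>2)))"
    then have ij: "i < n" "j < n" by auto
    have "(mat_adjoint ?R * ?R) $$ (i, j) = (\<Sum>l<m. mat_adjoint ?R $$ (i, l) * ?R $$ (l, j))"
      using ij by (intro mult_mat_index[of _ n m _ n]) auto
    also have "\<dots> = (\<Sum>l<m. if l = i then (if i = j then complex_of_real ((\<delta> i)\<^sup>2) else 0) else 0)"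
      using ij by (intro sum.cong) (auto simp: power2_eq_square)
    also have "\<dots> = mat_diag n (\<lambda>i. complex_of_real ((\<rho> i)\<^sup>2)) $$ (i, j)"
      using ij by (auto simp: mat_diag_def \<rho>_def simp flip: of_real_power)
    finally show "(mat_adjoint ?R * ?R) $$ (i, j) = mat_diag n (\<lambda>i. complex_of_real ((\<rho> i)\<^sup>2)) $$ (i, j)" .
  qed auto
  have AA: "mat_adjoint A * A = W * mat_diag n (\<lambda>i. complex_of_real ((\<rho> i)\<^sup>2)) * mat_adjoint W"
  proof -
    let ?B = "V * ?R"
    have B: "?B \<in> carrier_mat m n" using v by auto
    have "mat_adjoint ?B * ?B = mat_adjoint ?R * (mat_adjoint V * (V * ?R))"
      using v by (simp add: mat_adjoint_mult[of V m m ?R n] assoc_mult_mat[of _ n m _ m _ n])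
    also have "\<dots> = mat_diag n (\<lambda>i. complex_of_real ((\<rho> i)\<^sup>2))"
      using unitary_cancel_mat(2)[OF V, of ?R n] by (simp add: RR)
    finally have BB: "mat_adjoint ?B * ?B = mat_diag n (\<lambda>i. complex_of_real ((\<rho> i)\<^sup>2))" .
    have "mat_adjoint A * A = (W * mat_adjoint ?B) * (?B * mat_adjoint W)"
      unfolding AV using B w by (subst mat_adjoint_mult[of ?B m n _ n]) auto
    also have "\<dots> = W * (mat_adjoint ?B * (?B * mat_adjoint W))"
      using B w by (intro assoc_mult_mat[of _ n n _ m _ n]) auto
    also have "mat_adjoint ?B * (?B * mat_adjoint W) = (mat_adjoint ?B * ?B) * mat_adjoint W"
      using B w by (intro assoc_mult_mat[symmetric, of _ n m _ n _ n]) auto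
    finally show ?thesis
      unfolding BB using w by (simp add: assoc_mult_mat_dim)
  qed
  have "0 \<le> \<rho> i" for i by (simp add: \<rho>_def)
  then have ev: "eigenvalues_desc (psd_sqrt (mat_adjoint A * A)) = rev (sort (map \<rho> [0..<n]))"
    unfolding AA by (simp only: psd_sqrt_diag[OF W] eigenvalues_desc_diag[OF W])
  let ?xs = "rev (sort (map (\<lambda>i. \<bar>\<delta> i\<bar>) [0..<?q]))"
  have "[0..<n] = [0..<?q] @ [?q..<n]"
    by (metis le_add_diff_inverse min.cobounded2 upt_add_eq_append zero_le)
  then have "map \<rho> [0..<n] = map (\<lambda>i. \<bar>\<delta> i\<bar>) [0..<?q] @ replicate (n - ?q) 0"
    by (auto simp: \<rho>_def min_def intro!: nth_equalityI)
  then have "sort (map \<rho> [0..<n]) = replicate (n - ?q) 0 @ sort (map (\<lambda>i. \<bar>\<delta> i\<bar>) [0..<?q])"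
    by (intro properties_for_sort) (auto simp: sorted_append)
  then have "eigenvalues_desc (psd_sqrt (mat_adjoint A * A)) = ?xs @ replicate (n - ?q) 0"
    by (simp add: ev)
  then have "singular_value A i = ?xs ! i" if "i < ?q" for i
    using that by (simp add: singular_value_def nth_append)
  then show ?thesis
    by (intro nth_equalityI) auto
qed

corollary singular_value_rect_diag:
  assumes "unitary_mat m V" "unitary_mat n W" "A = V * rect_diag m n \<sigma> * mat_adjoint W"
    and nonneg: "\<And>i. i < min m n \<Longrightarrow> 0 \<le> \<sigma> i"
    and anti: "\<And>i j. i \<le> j \<Longrightarrow> j < min m n \<Longrightarrow> \<sigma> j \<le> \<sigma> i"
    and i: "i < min m n"
  shows "singular_value A i = \<sigma> i"
proof -
  let ?q = "min m n"
  have "sort (map (\<lambda>i. \<bar>\<sigma> i\<bar>) [0..<?q]) = rev (map \<sigma> [0..<?q])"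
  proof (rule properties_for_sort)
    show "sorted (rev (map \<sigma> [0..<?q]))"
      unfolding sorted_rev_iff_nth_mono using anti by auto
    show "mset (rev (map \<sigma> [0..<?q])) = mset (map (\<lambda>i. \<bar>\<sigma> i\<bar>) [0..<?q])"
      using nonneg by (auto intro!: arg_cong[of _ _ mset] image_mset_cong)
  qed
  then have "map (singular_value A) [0..<?q] = map \<sigma> [0..<?q]"
    by (simp add: singular_values_of_rect_diag[OF assms(1-3)])
  from arg_cong[OF this, of "\<lambda>xs. xs ! i"] i show ?thesis by simp
qed

text \<open>The column space of \<open>A\<close> is the span of the first \<open>r\<close> columns of \<open>V\<close>, which are linearly independent.\<close>

lemma rank_rect_diag:
  assumes V: "unitary_mat m V" and W: "unitary_mat n W"
    and AV: "A = V * rect_diag m n \<delta> * mat_adjoint W"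
    and r: "r \<le> min m n" and nz: "\<And>i. i < min m n \<Longrightarrow> \<delta> i \<noteq> 0 \<longleftrightarrow> i < r"
  shows "vec_space.rank m A = r"
proof -
  interpret vec_space "TYPE(complex)" m .
  note v = unitary_matD[OF V] and w = unitary_matD[OF W]
  have A: "A \<in> carrier_mat m n" using v w by (auto simp: AV)
  define B where "B = mat m r (\<lambda>(i, j). V $$ (i, j))"
  have B: "B \<in> carrier_mat m r" by (simp add: B_def)
  define ext where "ext x = vec m (\<lambda>i. if i < r then x $ i else 0)" for x :: "complex vec"
  have ext: "ext x \<in> carrier_vec m" for x by (simp add: ext_def)
  have Bx: "B *\<^sub>v x = V *\<^sub>v ext x" if "x \<in> carrier_vec r" for x
  proof (rule eq_vecI)
    fix i assume "i < dim_vec (V *\<^sub>v ext x)"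
    then have i: "i < m" using v by simp
    have "(V *\<^sub>v ext x) $ i = (\<Sum>j<m. V $$ (i, j) * (if j < r then x $ j else 0))"
      using i v ext by (subst mult_mat_vec_index[of _ m m]) (auto simp: ext_def)
    also have "\<dots> = (\<Sum>j<r. V $$ (i, j) * x $ j)"
      using r by (intro sum.mono_neutral_cong_right) auto
    also have "\<dots> = (B *\<^sub>v x) $ i"
      using i that by (subst mult_mat_vec_index[of _ m r]) (auto simp: B_def)
    finally show "(B *\<^sub>v x) $ i = (V *\<^sub>v ext x) $ i" by simp
  qed (use v B in auto)
  have Ay: "A *\<^sub>v y = V *\<^sub>v (rect_diag m n \<delta> *\<^sub>v (mat_adjoint W *\<^sub>v y))" if "y \<in> carrier_vec n" for y
  proof -
    have "A *\<^sub>v y = (V * rect_diag m n \<delta>) *\<^sub>v (mat_adjoint W *\<^sub>v y)"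
      unfolding AV using v w that by (intro assoc_mult_mat_vec[of _ m n _ n]) auto
    then show ?thesis
      using v w by (subst (asm) assoc_mult_mat_vec[of _ m m _ n]) auto
  qed
  have "col_space A = col_space B"
    unfolding col_space_eq[OF A] col_space_eq[OF B]
  proof (intro equalityI subsetI)
    fix y assume "y \<in> {y \<in> carrier_vec (dim_row A). \<exists>x\<in>carrier_vec (dim_col A). A *\<^sub>v x = y}"
    then obtain x where x: "x \<in> carrier_vec n" "A *\<^sub>v x = y" using A by auto
    let ?z = "mat_adjoint W *\<^sub>v x"
    have "rect_diag m n \<delta> *\<^sub>v ?z = ext (vec r (\<lambda>i. complex_of_real (\<delta> i) * ?z $ i))"
    proof (rule eq_vecI)
      fix i assume "i < dim_vec (ext (vec r (\<lambda>i. complex_of_real (\<delta> i) * ?z $ i)))"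
      then have "i < m" by (simp add: ext_def)
      then show "(rect_diag m n \<delta> *\<^sub>v ?z) $ i = ext (vec r (\<lambda>i. complex_of_real (\<delta> i) * ?z $ i)) $ i"
        using nz[of i] r w by (subst rect_diag_mult_vec_index) (auto simp: ext_def)
    qed (auto simp: ext_def)
    then have "y = B *\<^sub>v vec r (\<lambda>i. complex_of_real (\<delta> i) * ?z $ i)"
      using x Ay[OF x(1)] by (simp add: Bx)
    then show "y \<in> {y \<in> carrier_vec (dim_row B). \<exists>x\<in>carrier_vec (dim_col B). B *\<^sub>v x = y}"
      using B by auto
  next
    fix y assume "y \<in> {y \<in> carrier_vec (dim_row B). \<exists>x\<in>carrier_vec (dim_col B). B *\<^sub>v x = y}"
    then obtain x where x: "x \<in> carrier_vec r" "B *\<^sub>v x = y" using B by auto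
    define z where "z = vec n (\<lambda>i. if i < r then x $ i / complex_of_real (\<delta> i) else 0)"
    have z: "z \<in> carrier_vec n" by (simp add: z_def)
    have "rect_diag m n \<delta> *\<^sub>v z = ext x"
    proof (rule eq_vecI)
      fix i assume "i < dim_vec (ext x)"
      then have "i < m" by (simp add: ext_def)
      then show "(rect_diag m n \<delta> *\<^sub>v z) $ i = ext x $ i"
        using nz[of i] r z by (subst rect_diag_mult_vec_index) (auto simp: ext_def z_def)
    qed (auto simp: ext_def)
    then have "A *\<^sub>v (W *\<^sub>v z) = y"
      using x w z by (simp add: Ay unitary_cancel_vec(2)[OF W z] Bx)
    then show "y \<in> {y \<in> carrier_vec (dim_row A). \<exists>x\<in>carrier_vec (dim_col A). A *\<^sub>v x = y}"
      using A w z by (auto intro!: bexI[of _ "W *\<^sub>v z"])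
  qed
  then have "rank A = rank B"
    by (simp add: rank_def col_space_def)
  also have "rank B = r"
  proof -
    have inj: "x = 0\<^sub>v r" if x: "x \<in> carrier_vec r" and "B *\<^sub>v x = 0\<^sub>v m" for x
    proof -
      have "ext x = mat_adjoint V *\<^sub>v 0\<^sub>v m"
        using that unitary_cancel_vec(2)[OF V ext[of x]] by (simp add: Bx)
      also have "\<dots> = 0\<^sub>v m" using v by (auto intro!: eq_vecI)
      finally have e: "ext x = 0\<^sub>v m" .
      show ?thesis
      proof (rule eq_vecI)
        fix i assume "i < dim_vec (0\<^sub>v r :: complex vec)"
        then show "x $ i = 0\<^sub>v r $ i"
          using r arg_cong[OF e, of "\<lambda>v. v $ i"] by (simp add: ext_def)
      qed (use x in simp)
    qed
    have "distinct (cols B)"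
      unfolding distinct_conv_nth
    proof (intro allI impI)
      fix i j assume ij: "i < length (cols B)" "j < length (cols B)" "i \<noteq> j"
      then have ij': "i < r" "j < r" "i < m" "j < m" using B r by auto
      have "col B i = col V i" "col B j = col V j"
        using ij' v by (auto simp: B_def intro!: eq_vecI)
      moreover have "col V i \<noteq> col V j"
        using V ij' ij(3) unfolding unitary_mat_iff_cols[OF v(1)] by (metis zero_neq_one)
      ultimately show "cols B ! i \<noteq> cols B ! j"
        using ij by simp
    qed
    moreover from this have "lin_indpt (set (cols B))"
      using lin_depE[OF B] inj by blast
    ultimately show ?thesis
      by (intro lin_indpt_full_rank[OF B])
  qed
  finally show ?thesis .
qed

section \<open>Mirsky's inequality\<close>

text \<open>One half of the Courant-Fischer principle. The orthogonal complement of the first \<open>i\<close> eigenvectors and the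
subspace cut out by the functionals have codimensions adding up to less than \<open>N\<close>, so they share a nonzero
vector \<open>v\<close>; its quadratic form is at least \<open>c \<parallel>v\<parallel>\<^sup>2\<close> and at most \<open>\<mu>\<^sub>i \<parallel>v\<parallel>\<^sup>2\<close>.\<close>

lemma courant_fischer_lower_bound:
  assumes Q: "unitary_mat N Q" and G: "G = Q * mat_diag N (\<lambda>i. complex_of_real (\<mu> i)) * mat_adjoint Q"
    and anti: "\<And>i j. i \<le> j \<Longrightarrow> j < N \<Longrightarrow> \<mu> j \<le> \<mu> i"
    and lf: "\<And>\<phi>. \<phi> \<in> set \<phi>s \<Longrightarrow> linear_functional N \<phi>" and len: "length \<phi>s + i < N"
    and low: "\<And>v. v \<in> carrier_vec N \<Longrightarrow> \<forall>\<phi>\<in>set \<phi>s. \<phi> v = 0 \<Longrightarrow>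
      c * sqnorm v \<le> Re ((G *\<^sub>v v) \<bullet>c v)"
  shows "c \<le> \<mu> i"
proof -
  note q = unitary_matD[OF Q]
  let ?\<psi>s = "map (\<lambda>l v. (mat_adjoint Q *\<^sub>v v) $ l) [0..<i]"
  have lf': "linear_functional N \<phi>" if "\<phi> \<in> set (\<phi>s @ ?\<psi>s)" for \<phi>
    using that lf q len by (auto simp del: index_mult_mat_vec intro: linear_functional_row[of _ N])
  have "length (\<phi>s @ ?\<psi>s) < N" using len by simp
  from common_zero_of_functionals[OF lf' this]
  obtain v where v: "v \<in> carrier_vec N" "v \<noteq> 0\<^sub>v N" and ann: "\<And>\<phi>. \<phi> \<in> set (\<phi>s @ ?\<psi>s) \<Longrightarrow> \<phi> v = 0"
    by blast
  let ?z = "mat_adjoint Q *\<^sub>v v"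
  have z0: "?z $ l = 0" if "l < i" for l
    using ann[of "\<lambda>v. (mat_adjoint Q *\<^sub>v v) $ l"] that by simp
  have z: "?z \<in> carrier_vec N" using q by simp
  have "c * sqnorm v \<le> Re ((G *\<^sub>v v) \<bullet>c v)"
    using ann by (intro low[OF v(1)]) auto
  also have "\<dots> = (\<Sum>l<N. \<mu> l * (cmod (?z $ l))\<^sup>2)"
    unfolding G quadratic_form_diag[OF q(1) v(1)] by simp
  also have "\<dots> \<le> (\<Sum>l<N. \<mu> i * (cmod (?z $ l))\<^sup>2)"
  proof (rule sum_mono)
    fix l assume l: "l \<in> {..<N}"
    show "\<mu> l * (cmod (?z $ l))\<^sup>2 \<le> \<mu> i * (cmod (?z $ l))\<^sup>2"
    proof (cases "l < i")
      case True
      then show ?thesis by (simp only: z0) simp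
    next
      case False
      then show ?thesis using l anti[of i l] by (intro mult_right_mono) auto
    qed
  qed
  also have "\<dots> = \<mu> i * sqnorm v"
    using unitary_adjoint_sqnorm[OF Q v(1)] by (simp add: sqnorm_carrier[OF z] flip: sum_distrib_left)
  finally have "c * sqnorm v \<le> \<mu> i * sqnorm v" .
  moreover have "0 < sqnorm v"
    using v sqnorm_eq_0_iff[OF v(1)] sqnorm_nonneg[of v] by linarith
  ultimately show ?thesis by simp
qed

lemma cscalar_append:
  fixes x x' y y' :: "complex vec"
  assumes "x \<in> carrier_vec m" "x' \<in> carrier_vec m" "y \<in> carrier_vec n" "y' \<in> carrier_vec n"
  shows "(x @\<^sub>v y) \<bullet>c (x' @\<^sub>v y') = x \<bullet>c x' + y \<bullet>c y'"
proof -
  have "conjugate (x' @\<^sub>v y') = conjugate x' @\<^sub>v conjugate y'"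
    using assms by (intro eq_vecI) auto
  then show ?thesis
    using assms by (simp add: scalar_prod_append[of _ m _ n])
qed

lemma sqnorm_append:
  assumes "x \<in> carrier_vec m" "y \<in> carrier_vec n"
  shows "sqnorm (x @\<^sub>v y) = sqnorm x + sqnorm y"
proof -
  have "complex_of_real (sqnorm (x @\<^sub>v y)) = complex_of_real (sqnorm x + sqnorm y)"
    using assms by (simp add: cscalar_self[symmetric] cscalar_append)
  then show ?thesis by (simp only: of_real_eq_iff)
qed

lemma linear_functional_vec_first:
  assumes "linear_functional m \<phi>"
  shows "linear_functional (m + n) (\<lambda>v. \<phi> (vec_first v m))"
proof -
  obtain r where r: "r \<in> carrier_vec m" "\<And>v. v \<in> carrier_vec m \<Longrightarrow> \<phi> v = r \<bullet> v"
    using assms by (auto simp: linear_functional_def)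
  have "\<phi> (vec_first v m) = (r @\<^sub>v 0\<^sub>v n) \<bullet> v" if "v \<in> carrier_vec (m + n)" for v
  proof -
    have "(r @\<^sub>v 0\<^sub>v n) \<bullet> (vec_first v m @\<^sub>v vec_last v n) = r \<bullet> vec_first v m + 0\<^sub>v n \<bullet> vec_last v n"
      by (rule scalar_prod_append[of _ m _ n]) (use r in auto)
    then show ?thesis using that r by simp
  qed
  then show ?thesis
    using r unfolding linear_functional_def by (intro bexI[of _ "r @\<^sub>v 0\<^sub>v n"]) auto
qed

lemma linear_functional_vec_last:
  assumes "linear_functional n \<phi>"
  shows "linear_functional (m + n) (\<lambda>v. \<phi> (vec_last v n))"
proof -
  obtain r where r: "r \<in> carrier_vec n" "\<And>v. v \<in> carrier_vec n \<Longrightarrow> \<phi> v = r \<bullet> v"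
    using assms by (auto simp: linear_functional_def)
  have "\<phi> (vec_last v n) = (0\<^sub>v m @\<^sub>v r) \<bullet> v" if "v \<in> carrier_vec (m + n)" for v
  proof -
    have "(0\<^sub>v m @\<^sub>v r) \<bullet> (vec_first v m @\<^sub>v vec_last v n) = 0\<^sub>v m \<bullet> vec_first v m + r \<bullet> vec_last v n"
      by (rule scalar_prod_append[of _ m _ n]) (use r in auto)
    then show ?thesis using that r by simp
  qed
  then show ?thesis
    using r unfolding linear_functional_def by (intro bexI[of _ "0\<^sub>v m @\<^sub>v r"]) auto
qed

text \<open>In the coordinates \<open>V\<^sup>* x\<close> and \<open>W\<^sup>* y\<close> the sesquilinear form of \<open>A\<close> is diagonal.\<close>

lemma cscalar_svd:
  assumes V: "unitary_mat m V" and W: "unitary_mat n W"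
    and A: "A = V * rect_diag m n \<sigma> * mat_adjoint W"
    and x: "x \<in> carrier_vec m" and y: "y \<in> carrier_vec n"
  shows "(A *\<^sub>v y) \<bullet>c x =
    (\<Sum>l<min m n. complex_of_real (\<sigma> l) * ((mat_adjoint W *\<^sub>v y) $ l * cnj ((mat_adjoint V *\<^sub>v x) $ l)))"
proof -
  note v = unitary_matD[OF V] and w = unitary_matD[OF W]
  let ?b = "mat_adjoint W *\<^sub>v y" and ?a = "mat_adjoint V *\<^sub>v x"
  have b: "?b \<in> carrier_vec n" and a: "?a \<in> carrier_vec m" using v w by auto
  have "A *\<^sub>v y = V *\<^sub>v (rect_diag m n \<sigma> *\<^sub>v ?b)"
    using v w y by (simp add: A assoc_mult_mat_vec_dim)
  then have "(A *\<^sub>v y) \<bullet>c x = (rect_diag m n \<sigma> *\<^sub>v ?b) \<bullet>c ?a"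
    using x by (simp add: cscalar_adjoint[OF v(1)])
  also have "\<dots> = (\<Sum>l<m. (if l < n then complex_of_real (\<sigma> l) * ?b $ l else 0) * cnj (?a $ l))"
    using a b by (subst cscalar_sum[of _ m]) (auto simp: rect_diag_mult_vec_index simp del: index_mult_mat_vec)
  also have "\<dots> = (\<Sum>l<min m n. complex_of_real (\<sigma> l) * (?b $ l * cnj (?a $ l)))"
    by (rule sum.mono_neutral_cong_right) (auto simp: mult.assoc)
  finally show ?thesis .
qed

text \<open>The Hermitian dilation turns singular values into eigenvalues: for singular vectors \<open>v\<^sub>i\<close>, \<open>w\<^sub>i\<close> of \<open>A\<close>, the vectors
\<open>(v\<^sub>i, \<plusminus>w\<^sub>i)\<close> are eigenvectors for \<open>\<plusminus>s\<^sub>i(A)\<close>.\<close>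

definition dilation :: "complex mat \<Rightarrow> complex mat" where
  "dilation A = four_block_mat (0\<^sub>m (dim_row A) (dim_row A)) A (mat_adjoint A) (0\<^sub>m (dim_col A) (dim_col A))"

lemma dilation_carrier: "A \<in> carrier_mat m n \<Longrightarrow> dilation A \<in> carrier_mat (m + n) (m + n)"
  by (auto simp: dilation_def)

lemma dilation_adjoint: "mat_adjoint (dilation A) = dilation A"
  by (rule eq_matI) (auto simp: dilation_def)

lemma dilation_form:
  assumes A: "A \<in> carrier_mat m n" and v: "v \<in> carrier_vec (m + n)"
  shows "Re ((dilation A *\<^sub>v v) \<bullet>c v) = 2 * Re ((A *\<^sub>v vec_last v n) \<bullet>c vec_first v m)"
proof -
  let ?x = "vec_first v m" and ?y = "vec_last v n"
  have x: "?x \<in> carrier_vec m" and y: "?y \<in> carrier_vec n" by auto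
  have vxy: "v = ?x @\<^sub>v ?y" using v by simp
  have "dilation A *\<^sub>v (?x @\<^sub>v ?y) =
      (0\<^sub>m m m *\<^sub>v ?x + A *\<^sub>v ?y) @\<^sub>v (mat_adjoint A *\<^sub>v ?x + 0\<^sub>m n n *\<^sub>v ?y)"
    using A x y unfolding dilation_def by (subst four_block_mat_mult_vec[of _ m m _ n _ n]) auto
  also have "\<dots> = (A *\<^sub>v ?y) @\<^sub>v (mat_adjoint A *\<^sub>v ?x)"
    using A by (intro arg_cong2[of _ _ _ _ append_vec] eq_vecI) auto
  finally have "(dilation A *\<^sub>v v) \<bullet>c v = (A *\<^sub>v ?y) \<bullet>c ?x + (mat_adjoint A *\<^sub>v ?x) \<bullet>c ?y"
    using A cscalar_append[OF _ x _ y, of "A *\<^sub>v ?y" "mat_adjoint A *\<^sub>v ?x"] v by simp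
  moreover have "(mat_adjoint A *\<^sub>v ?x) \<bullet>c ?y = cnj ((A *\<^sub>v ?y) \<bullet>c ?x)"
  proof -
    have "(mat_adjoint A *\<^sub>v ?x) \<bullet>c ?y = ?x \<bullet>c (A *\<^sub>v ?y)"
      using A x y by (subst cscalar_adjoint[of _ n m]) auto
    also have "\<dots> = cnj ((A *\<^sub>v ?y) \<bullet>c ?x)"
      using A x by (simp add: cscalar_sum[of _ m] mult.commute del: index_mult_mat_vec)
    finally show ?thesis .
  qed
  ultimately show ?thesis by simp
qed

lemma dilation_form_svd:
  assumes V: "unitary_mat m V" and W: "unitary_mat n W"
    and A: "A = V * rect_diag m n \<sigma> * mat_adjoint W" and v: "v \<in> carrier_vec (m + n)"
  shows "Re ((dilation A *\<^sub>v v) \<bullet>c v) =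
    (\<Sum>l<min m n. \<sigma> l * (2 * Re ((mat_adjoint W *\<^sub>v vec_last v n) $ l *
        cnj ((mat_adjoint V *\<^sub>v vec_first v m) $ l))))"
proof -
  have "A \<in> carrier_mat m n" using V W by (auto simp: A unitary_mat_def)
  from dilation_form[OF this v] show ?thesis
    by (subst (asm) cscalar_svd[OF V W A]) (auto simp: sum_distrib_left mult_ac simp del: index_mult_mat_vec)
qed

lemma sqnorm_coordinates:
  assumes V: "unitary_mat m V" and W: "unitary_mat n W" and v: "v \<in> carrier_vec (m + n)"
  shows "sqnorm v = (\<Sum>l<m. (cmod ((mat_adjoint V *\<^sub>v vec_first v m) $ l))\<^sup>2) +
    (\<Sum>l<n. (cmod ((mat_adjoint W *\<^sub>v vec_last v n) $ l))\<^sup>2)"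
proof -
  note vv = unitary_matD[OF V] and w = unitary_matD[OF W]
  have "sqnorm v = sqnorm (vec_first v m) + sqnorm (vec_last v n)"
    using sqnorm_append[of "vec_first v m" m "vec_last v n" n] v by simp
  also have "\<dots> = sqnorm (mat_adjoint V *\<^sub>v vec_first v m) + sqnorm (mat_adjoint W *\<^sub>v vec_last v n)"
    using unitary_adjoint_sqnorm[OF V] unitary_adjoint_sqnorm[OF W] by simp
  finally show ?thesis
    using vv w by (simp add: sqnorm_carrier[of _ m] sqnorm_carrier[of _ n] del: index_mult_mat_vec)
qed

lemma two_Re_mult_cnj:
  "2 * Re (b * cnj a) = (cmod (a + b))\<^sup>2 - (cmod a)\<^sup>2 - (cmod b)\<^sup>2"
  "2 * Re (b * cnj a) = (cmod a)\<^sup>2 + (cmod b)\<^sup>2 - (cmod (a - b))\<^sup>2"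
  unfolding cmod_power2 by (simp_all add: power2_eq_square algebra_simps)

lemma two_Re_mult_cnj_le: "\<bar>2 * Re (b * cnj a)\<bar> \<le> (cmod a)\<^sup>2 + (cmod b)\<^sup>2"
  using two_Re_mult_cnj[of b a] zero_le_power2[of "cmod (a + b)"] zero_le_power2[of "cmod (a - b)"]
  by (simp only: abs_le_iff) linarith

lemma linear_functional_coordinates:
  assumes "unitary_mat m V" "l < m"
  shows "linear_functional (m + n) (\<lambda>v. (mat_adjoint V *\<^sub>v vec_first v m) $ l)"
    "linear_functional (n + m) (\<lambda>v. (mat_adjoint V *\<^sub>v vec_last v m) $ l)"
  using linear_functional_vec_first[OF linear_functional_row] linear_functional_vec_last[OF linear_functional_row]
    unitary_matD(2)[OF assms(1)] assms(2) by blast+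

text \<open>The functionals cut out the span of \<open>(v\<^sub>l, w\<^sub>l)\<close> for \<open>l \<le> i\<close>, where the dilation is at least \<open>\<sigma>\<^sub>i\<close>. In the
coordinates \<open>a = V\<^sup>* x\<close> and \<open>b = W\<^sup>* y\<close> this is \<open>a\<^sub>l = b\<^sub>l\<close> for \<open>l \<le> i\<close> and \<open>a\<^sub>l = b\<^sub>l = 0\<close> beyond.\<close>

lemma dilation_top_subspace:
  assumes V: "unitary_mat m V" and W: "unitary_mat n W"
    and A: "A = V * rect_diag m n \<sigma> * mat_adjoint W"
    and anti: "\<And>i j. i \<le> j \<Longrightarrow> \<sigma> j \<le> \<sigma> i" and i: "i < min m n"
  obtains \<phi>s where "\<And>\<phi>. \<phi> \<in> set \<phi>s \<Longrightarrow> linear_functional (m + n) \<phi>" "length \<phi>s + i < m + n"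
    "\<And>v. v \<in> carrier_vec (m + n) \<Longrightarrow> \<forall>\<phi>\<in>set \<phi>s. \<phi> v = 0 \<Longrightarrow>
      \<sigma> i * sqnorm v \<le> Re ((dilation A *\<^sub>v v) \<bullet>c v)"
proof -
  define a where "a v l = (mat_adjoint V *\<^sub>v vec_first v m) $ l" for v l
  define b where "b v l = (mat_adjoint W *\<^sub>v vec_last v n) $ l" for v l
  have lfa: "linear_functional (m + n) (\<lambda>v. a v l)" if "l < m" for l
    unfolding a_def by (rule linear_functional_coordinates[OF V that])
  have lfb: "linear_functional (m + n) (\<lambda>v. b v l)" if "l < n" for l
    unfolding b_def by (rule linear_functional_coordinates[OF W that])
  define \<phi>s where "\<phi>s = map (\<lambda>l v. a v l - b v l) [0..<Suc i] @
    map (\<lambda>l v. a v l) [Suc i..<m] @ map (\<lambda>l v. b v l) [Suc i..<n]"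
  show ?thesis
  proof (rule that[of \<phi>s])
    show "linear_functional (m + n) \<phi>" if "\<phi> \<in> set \<phi>s" for \<phi>
      using that i lfa lfb by (auto simp: \<phi>s_def simp del: upt_Suc intro!: linear_functional_diff)
    show "length \<phi>s + i < m + n"
      using i by (auto simp: \<phi>s_def simp del: upt_Suc)
    fix v assume v: "v \<in> carrier_vec (m + n)" and ann': "\<forall>\<phi>\<in>set \<phi>s. \<phi> v = 0"
    note ann = bspec[OF ann']
    have eq: "a v l = b v l" if "l \<le> i" for l
      using ann[of "\<lambda>v. a v l - b v l"] that by (auto simp: \<phi>s_def simp del: upt_Suc)
    have a0: "a v l = 0" if "i < l" "l < m" for l
      using ann[of "\<lambda>v. a v l"] that by (auto simp: \<phi>s_def simp del: upt_Suc)
    have b0: "b v l = 0" if "i < l" "l < n" for l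
      using ann[of "\<lambda>v. b v l"] that by (auto simp: \<phi>s_def simp del: upt_Suc)
    have sa: "(\<Sum>l<m. (cmod (a v l))\<^sup>2) = (\<Sum>l<Suc i. (cmod (b v l))\<^sup>2)"
      using i a0 eq by (intro sum.mono_neutral_cong_right) auto
    have sb: "(\<Sum>l<n. (cmod (b v l))\<^sup>2) = (\<Sum>l<Suc i. (cmod (b v l))\<^sup>2)"
      using i b0 by (intro sum.mono_neutral_cong_right) auto
    have "\<sigma> i * sqnorm v = (\<Sum>l<Suc i. \<sigma> i * (2 * (cmod (b v l))\<^sup>2))"
      unfolding sqnorm_coordinates[OF V W v, folded a_def b_def] sa sb
      by (simp add: sum_distrib_left algebra_simps)
    also have "\<dots> \<le> (\<Sum>l<Suc i. \<sigma> l * (2 * (cmod (b v l))\<^sup>2))"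
      using anti by (intro sum_mono mult_right_mono) auto
    also have "\<dots> = (\<Sum>l<Suc i. \<sigma> l * (2 * Re (b v l * cnj (a v l))))"
      using eq by (intro sum.cong) (auto simp: complex_mult_cnj cmod_power2)
    also have "\<dots> = (\<Sum>l<min m n. \<sigma> l * (2 * Re (b v l * cnj (a v l))))"
      using i a0 by (intro sum.mono_neutral_left) auto
    also have "\<dots> = Re ((dilation A *\<^sub>v v) \<bullet>c v)"
      unfolding dilation_form_svd[OF V W A v] a_def b_def ..
    finally show "\<sigma> i * sqnorm v \<le> Re ((dilation A *\<^sub>v v) \<bullet>c v)" .
  qed
qed

text \<open>The functionals cut out the orthogonal complement of \<open>(v\<^sub>l, -w\<^sub>l)\<close> for \<open>l < i\<close>, that is \<open>a\<^sub>l = b\<^sub>l\<close> for \<open>l < i\<close>. These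
coordinates contribute nonnegatively, and the others at least \<open>- \<sigma>\<^sub>l (\<bar>a\<^sub>l\<bar>\<^sup>2 + \<bar>b\<^sub>l\<bar>\<^sup>2)\<close>. The bound \<open>s\<close> is separate
from \<open>\<sigma>\<^sub>i\<close> so that \<open>i = min m n\<close> with \<open>s = 0\<close> is covered, which handles the zero eigenvalues in the middle.\<close>

lemma dilation_bottom_subspace:
  assumes V: "unitary_mat m V" and W: "unitary_mat n W"
    and A: "A = V * rect_diag m n \<sigma> * mat_adjoint W"
    and nonneg: "\<And>l. 0 \<le> \<sigma> l" and i: "i \<le> min m n"
    and s: "0 \<le> s" "\<And>l. i \<le> l \<Longrightarrow> l < min m n \<Longrightarrow> \<sigma> l \<le> s"
  obtains \<phi>s where "\<And>\<phi>. \<phi> \<in> set \<phi>s \<Longrightarrow> linear_functional (m + n) \<phi>" "length \<phi>s = i"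
    "\<And>v. v \<in> carrier_vec (m + n) \<Longrightarrow> \<forall>\<phi>\<in>set \<phi>s. \<phi> v = 0 \<Longrightarrow>
      - s * sqnorm v \<le> Re ((dilation A *\<^sub>v v) \<bullet>c v)"
proof -
  define a where "a v l = (mat_adjoint V *\<^sub>v vec_first v m) $ l" for v l
  define b where "b v l = (mat_adjoint W *\<^sub>v vec_last v n) $ l" for v l
  have lfa: "linear_functional (m + n) (\<lambda>v. a v l)" if "l < m" for l
    unfolding a_def by (rule linear_functional_coordinates[OF V that])
  have lfb: "linear_functional (m + n) (\<lambda>v. b v l)" if "l < n" for l
    unfolding b_def by (rule linear_functional_coordinates[OF W that])
  define \<phi>s where "\<phi>s = map (\<lambda>l v. a v l - b v l) [0..<i]"
  show ?thesis
  proof (rule that[of \<phi>s])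
    show "linear_functional (m + n) \<phi>" if "\<phi> \<in> set \<phi>s" for \<phi>
      using that i lfa lfb by (auto simp: \<phi>s_def intro!: linear_functional_diff)
    show "length \<phi>s = i" by (simp add: \<phi>s_def)
    fix v assume v: "v \<in> carrier_vec (m + n)" and ann': "\<forall>\<phi>\<in>set \<phi>s. \<phi> v = 0"
    note ann = bspec[OF ann']
    have eq: "a v l = b v l" if "l < i" for l
      using ann[of "\<lambda>v. a v l - b v l"] that by (auto simp: \<phi>s_def)
    have "(\<Sum>l<min m n. (cmod (a v l))\<^sup>2) \<le> (\<Sum>l<m. (cmod (a v l))\<^sup>2)"
      "(\<Sum>l<min m n. (cmod (b v l))\<^sup>2) \<le> (\<Sum>l<n. (cmod (b v l))\<^sup>2)"
      by (intro sum_mono2; auto)+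
    then have "(\<Sum>l<min m n. (cmod (a v l))\<^sup>2 + (cmod (b v l))\<^sup>2) \<le> sqnorm v"
      unfolding sqnorm_coordinates[OF V W v, folded a_def b_def] by (simp add: sum.distrib)
    then have "- s * sqnorm v \<le> - s * (\<Sum>l<min m n. (cmod (a v l))\<^sup>2 + (cmod (b v l))\<^sup>2)"
      using s(1) by (simp add: mult_left_mono)
    also have "\<dots> = (\<Sum>l<min m n. - s * ((cmod (a v l))\<^sup>2 + (cmod (b v l))\<^sup>2))"
      by (rule sum_distrib_left)
    also have "\<dots> \<le> (\<Sum>l<min m n. \<sigma> l * (2 * Re (b v l * cnj (a v l))))"
    proof (rule sum_mono)
      fix l assume l: "l \<in> {..<min m n}"
      let ?s = "(cmod (a v l))\<^sup>2 + (cmod (b v l))\<^sup>2" and ?r = "2 * Re (b v l * cnj (a v l))"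
      show "- s * ?s \<le> \<sigma> l * ?r"
      proof (cases "l < i")
        case True
        have "?r \<ge> 0"
          unfolding eq[OF True] complex_mult_cnj by simp
        then have "0 \<le> \<sigma> l * ?r"
          using nonneg by (rule mult_nonneg_nonneg[rotated])
        moreover have "0 \<le> s * ?s"
          using s(1) by (intro mult_nonneg_nonneg) auto
        ultimately show ?thesis by linarith
      next
        case False
        then have "\<sigma> l \<le> s" using l s(2) by auto
        have "\<sigma> l * - ?s \<le> \<sigma> l * ?r"
          using two_Re_mult_cnj_le[of "b v l" "a v l"] nonneg[of l]
          by (intro mult_left_mono) (simp_all only: abs_le_iff, linarith)
        moreover have "\<sigma> l * ?s \<le> s * ?s"
          using \<open>\<sigma> l \<le> s\<close> by (intro mult_right_mono) auto
        ultimately show ?thesis by (simp only: mult_minus_left mult_minus_right)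
      qed
    qed
    also have "\<dots> = Re ((dilation A *\<^sub>v v) \<bullet>c v)"
      unfolding dilation_form_svd[OF V W A v] a_def b_def ..
    finally show "- s * sqnorm v \<le> Re ((dilation A *\<^sub>v v) \<bullet>c v)" .
  qed
qed

text \<open>To be used with \<open>r = 2 Re (b a\<^sup>*)\<close> and \<open>s = \<bar>a\<bar>\<^sup>2 + \<bar>b\<bar>\<^sup>2\<close>, for which \<open>s + r = \<bar>a + b\<bar>\<^sup>2\<close>.\<close>

lemma mult_le_excess:
  fixes r s d t :: real
  assumes "r \<le> s" "0 \<le> s" "0 \<le> d" "0 \<le> t"
  shows "d * r \<le> t * s + max 0 (d - t) * ((s + r) / 2)"
proof (cases "d \<le> t")
  case True
  have "d * r \<le> d * s" using assms by (intro mult_left_mono)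
  also have "\<dots> \<le> t * s" using True assms by (intro mult_right_mono)
  finally show ?thesis using True by simp
next
  case False
  have "(d - t) * r \<le> (d - t) * ((s + r) / 2)"
    using False assms by (intro mult_left_mono) auto
  moreover have "t * r \<le> t * s" using assms by (intro mult_left_mono)
  moreover have "d * r = (d - t) * r + t * r" by (simp add: algebra_simps)
  moreover have "max 0 (d - t) = d - t" using False by simp
  ultimately show ?thesis by (simp only:)
qed

text \<open>With \<open>z\<^sub>l = (v\<^sub>l, w\<^sub>l) / \<surd>2\<close>, the unit eigenvector of the dilation for \<open>\<delta>\<^sub>l\<close>, take \<open>E = \<Sum> (\<delta>\<^sub>l - \<tau>)\<^sub>+ z\<^sub>l z\<^sub>l\<^sup>*\<close>. Only
the eigenvalues above \<open>\<tau>\<close> have to be compensated, and the negative ones never exceed \<open>\<tau> \<ge> 0\<close>. In coordinates the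
domination is a sum over \<open>l\<close> of scalar inequalities of the form \<open>mult_le_excess\<close>.\<close>

lemma dilation_excess:
  assumes V: "unitary_mat m V" and W: "unitary_mat n W"
    and D: "D = V * rect_diag m n \<delta> * mat_adjoint W"
    and nonneg: "\<And>l. 0 \<le> \<delta> l" and \<tau>: "0 \<le> \<tau>"
  obtains E where "E \<in> carrier_mat (m + n) (m + n)" "mat_adjoint E = E"
    "(\<Sum>i<m + n. E $$ (i, i)) = complex_of_real (\<Sum>l<min m n. max 0 (\<delta> l - \<tau>))"
    "\<And>v. v \<in> carrier_vec (m + n) \<Longrightarrow> 0 \<le> Re ((E *\<^sub>v v) \<bullet>c v)"
    "\<And>v. v \<in> carrier_vec (m + n) \<Longrightarrow>
      Re ((dilation D *\<^sub>v v) \<bullet>c v) \<le> \<tau> * sqnorm v + Re ((E *\<^sub>v v) \<bullet>c v)"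
proof -
  note vv = unitary_matD[OF V] and w = unitary_matD[OF W]
  let ?q = "min m n" and ?N = "m + n"
  define h where "h = complex_of_real (1 / sqrt 2)"
  define z where "z j = h \<cdot>\<^sub>v (col V j @\<^sub>v col W j)" for j
  define Z where "Z = mat_of_cols ?N (map z [0..<?q])"
  define c where "c l = max 0 (\<delta> l - \<tau>)" for l
  let ?E = "Z * mat_diag ?q (\<lambda>l. complex_of_real (c l)) * mat_adjoint Z"
  have Z: "Z \<in> carrier_mat ?N ?q" by (intro carrier_matI) (auto simp: Z_def)
  have zc: "z j \<in> carrier_vec ?N" if "j < ?q" for j
    using that vv w by (auto simp: z_def)
  have colZ: "col Z j = z j" if "j < ?q" for j
    using that zc by (simp add: Z_def)
  have hh: "(cmod h)\<^sup>2 = 1 / 2"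
    unfolding h_def norm_of_real by (simp add: power_divide)
  have sqz: "sqnorm (z j) = 1" if "j < ?q" for j
  proof -
    have "sqnorm (z j) = (cmod h)\<^sup>2 * sqnorm (col V j @\<^sub>v col W j)"
      by (simp add: z_def sqnorm_def norm_mult power_mult_distrib sum_distrib_left)
    also have "sqnorm (col V j @\<^sub>v col W j) = 2"
      using that vv w unitary_sqnorm_col[OF V, of j] unitary_sqnorm_col[OF W, of j] by (subst sqnorm_append[of _ m _ n]) auto
    finally show ?thesis by (simp add: hh)
  qed
  have form: "Re ((?E *\<^sub>v v) \<bullet>c v) = (\<Sum>l<?q. c l * ((cmod ((mat_adjoint V *\<^sub>v vec_first v m) $ l +
      (mat_adjoint W *\<^sub>v vec_last v n) $ l))\<^sup>2 / 2))" if v: "v \<in> carrier_vec ?N" for v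
  proof -
    have "Re ((?E *\<^sub>v v) \<bullet>c v) = (\<Sum>l<?q. c l * (cmod ((mat_adjoint Z *\<^sub>v v) $ l))\<^sup>2)"
      unfolding quadratic_form_diag[OF Z v] by simp
    also have "\<dots> = (\<Sum>l<?q. c l * ((cmod ((mat_adjoint V *\<^sub>v vec_first v m) $ l +
      (mat_adjoint W *\<^sub>v vec_last v n) $ l))\<^sup>2 / 2))"
    proof (rule sum.cong[OF refl])
      fix l assume "l \<in> {..<?q}"
      then have l: "l < m" "l < n" "l < ?q" by auto
      have "(mat_adjoint Z *\<^sub>v v) $ l = v \<bullet>c z l"
        using adjoint_mult_vec_index[OF Z v l(3)] colZ[OF l(3)] by simp
      also have "\<dots> = cnj h * ((vec_first v m @\<^sub>v vec_last v n) \<bullet>c (col V l @\<^sub>v col W l))"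
        using v vv w l by (simp add: z_def conjugate_smult_vec)
      also have "(vec_first v m @\<^sub>v vec_last v n) \<bullet>c (col V l @\<^sub>v col W l) =
          vec_first v m \<bullet>c col V l + vec_last v n \<bullet>c col W l"
        using vv w l by (intro cscalar_append[of _ m _ _ n]) auto
      also have "vec_first v m \<bullet>c col V l = (mat_adjoint V *\<^sub>v vec_first v m) $ l"
        using vv l by (intro adjoint_mult_vec_index[OF vv(1), symmetric]) auto
      also have "vec_last v n \<bullet>c col W l = (mat_adjoint W *\<^sub>v vec_last v n) $ l"
        using w l by (intro adjoint_mult_vec_index[OF w(1), symmetric]) auto
      finally have e: "(mat_adjoint Z *\<^sub>v v) $ l = cnj h * ((mat_adjoint V *\<^sub>v vec_first v m) $ l +
        (mat_adjoint W *\<^sub>v vec_last v n) $ l)" .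
      show "c l * (cmod ((mat_adjoint Z *\<^sub>v v) $ l))\<^sup>2 = c l * ((cmod ((mat_adjoint V *\<^sub>v vec_first v m) $ l +
        (mat_adjoint W *\<^sub>v vec_last v n) $ l))\<^sup>2 / 2)"
        unfolding e norm_mult power_mult_distrib complex_mod_cnj hh by simp
    qed
    finally show ?thesis .
  qed
  show ?thesis
  proof (rule that[of ?E])
    show "?E \<in> carrier_mat ?N ?N" using Z by auto
    show "mat_adjoint ?E = ?E" by (rule mat_adjoint_diag[OF Z])
    show "(\<Sum>i<m + n. ?E $$ (i, i)) = complex_of_real (\<Sum>l<?q. max 0 (\<delta> l - \<tau>))"
      unfolding trace_diag[OF Z] by (simp add: colZ sqz c_def)
    show "0 \<le> Re ((?E *\<^sub>v v) \<bullet>c v)" if "v \<in> carrier_vec ?N" for v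
      unfolding form[OF that] by (intro sum_nonneg mult_nonneg_nonneg) (auto simp: c_def)
    fix v :: "complex vec" assume v: "v \<in> carrier_vec ?N"
    define a where "a l = (mat_adjoint V *\<^sub>v vec_first v m) $ l" for l
    define b where "b l = (mat_adjoint W *\<^sub>v vec_last v n) $ l" for l
    have "(\<Sum>l<min m n. (cmod (a l))\<^sup>2) \<le> (\<Sum>l<m. (cmod (a l))\<^sup>2)"
      "(\<Sum>l<min m n. (cmod (b l))\<^sup>2) \<le> (\<Sum>l<n. (cmod (b l))\<^sup>2)"
      by (intro sum_mono2; auto)+
    then have "(\<Sum>l<min m n. (cmod (a l))\<^sup>2 + (cmod (b l))\<^sup>2) \<le> sqnorm v"
      unfolding sqnorm_coordinates[OF V W v, folded a_def b_def] by (simp add: sum.distrib)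
    then have norm: "\<tau> * (\<Sum>l<min m n. (cmod (a l))\<^sup>2 + (cmod (b l))\<^sup>2) \<le> \<tau> * sqnorm v"
      using \<tau> by (rule mult_left_mono)
    have "Re ((dilation D *\<^sub>v v) \<bullet>c v) = (\<Sum>l<?q. \<delta> l * (2 * Re (b l * cnj (a l))))"
      unfolding dilation_form_svd[OF V W D v] a_def b_def ..
    also have "\<dots> \<le> (\<Sum>l<?q. \<tau> * ((cmod (a l))\<^sup>2 + (cmod (b l))\<^sup>2) + c l * ((cmod (a l + b l))\<^sup>2 / 2))"
    proof (rule sum_mono)
      fix l
      let ?s = "(cmod (a l))\<^sup>2 + (cmod (b l))\<^sup>2" and ?r = "2 * Re (b l * cnj (a l))"
      have rs: "?r \<le> ?s"
        using two_Re_mult_cnj_le[of "b l" "a l"] by (simp only: abs_le_iff)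
      have s0: "0 \<le> ?s" by simp
      have sum: "(cmod (a l + b l))\<^sup>2 = ?s + ?r"
        using two_Re_mult_cnj(1)[of "b l" "a l"] by linarith
      show "\<delta> l * ?r \<le> \<tau> * ?s + c l * ((cmod (a l + b l))\<^sup>2 / 2)"
        unfolding sum c_def by (rule mult_le_excess[OF rs s0 nonneg \<tau>])
    qed
    also have "\<dots> \<le> \<tau> * sqnorm v + Re ((?E *\<^sub>v v) \<bullet>c v)"
      using norm unfolding form[OF v] by (simp add: sum.distrib a_def b_def flip: sum_distrib_left)
    finally show "Re ((dilation D *\<^sub>v v) \<bullet>c v) \<le> \<tau> * sqnorm v + Re ((?E *\<^sub>v v) \<bullet>c v)" .
  qed
qed

lemma sum_ge_paired_ends:
  fixes \<mu> :: "nat \<Rightarrow> real"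
  assumes "2 * q \<le> N" and "\<And>i. q \<le> i \<Longrightarrow> i < N - q \<Longrightarrow> 0 \<le> \<mu> i"
  shows "(\<Sum>i<q. \<mu> i + \<mu> (N - 1 - i)) \<le> (\<Sum>i<N. \<mu> i)"
proof -
  have "(\<Sum>i<N. \<mu> i) = (\<Sum>i<q. \<mu> i) + (\<Sum>i\<in>{q..<N - q}. \<mu> i) + (\<Sum>i\<in>{N - q..<N}. \<mu> i)"
    using assms(1) by (simp add: lessThan_atLeast0 sum.atLeastLessThan_concat)
  moreover have "(\<Sum>i\<in>{N - q..<N}. \<mu> i) = (\<Sum>i<q. \<mu> (N - 1 - i))"
    using assms(1) by (intro sum.reindex_bij_witness[of _ "\<lambda>i. N - 1 - i" "\<lambda>i. N - 1 - i"]) auto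
  moreover have "0 \<le> (\<Sum>i\<in>{q..<N - q}. \<mu> i)"
    using assms(2) by (intro sum_nonneg) auto
  ultimately show ?thesis by (simp add: sum.distrib)
qed

text \<open>Mirsky's inequality in terms of excesses over a threshold. The eigenvalues \<open>\<mu>\<close> of \<open>G = H(B) + E\<close> satisfy
\<open>\<mu>\<^sub>i \<ge> s\<^sub>i(B)\<close>, \<open>\<mu>\<^sub>i \<ge> s\<^sub>i(A) - \<tau>\<close> at the top and \<open>\<mu> \<ge> - s\<^sub>i(B)\<close>, \<open>\<mu> \<ge> - s\<^sub>i(A) - \<tau>\<close> for the \<open>i\<close>-th value from
the bottom. For each sign of \<open>s\<^sub>i(A) - s\<^sub>i(B)\<close> a suitable pair of these bounds adds up to
\<open>\<bar>s\<^sub>i(A) - s\<^sub>i(B)\<bar> - \<tau>\<close>, and the two bounds from \<open>B\<close> add up to \<open>0\<close>.\<close>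

theorem mirsky_excess:
  assumes A: "A \<in> carrier_mat m n" and B: "B \<in> carrier_mat m n" and \<tau>: "0 \<le> \<tau>"
  shows "(\<Sum>i<min m n. max 0 (\<bar>singular_value A i - singular_value B i\<bar> - \<tau>))
    \<le> (\<Sum>i<min m n. max 0 (singular_value (A - B) i - \<tau>))"
proof -
  let ?q = "min m n" and ?N = "m + n"
  obtain VA WA \<alpha> where svdA: "unitary_mat m VA" "unitary_mat n WA"
    "A = VA * rect_diag m n \<alpha> * mat_adjoint WA" and \<alpha>: "\<And>i. 0 \<le> \<alpha> i" "\<And>i j. i \<le> j \<Longrightarrow> \<alpha> j \<le> \<alpha> i"
    using full_svd_exists[OF A] by metis
  obtain VB WB \<beta> where svdB: "unitary_mat m VB" "unitary_mat n WB"
    "B = VB * rect_diag m n \<beta> * mat_adjoint WB" and \<beta>: "\<And>i. 0 \<le> \<beta> i" "\<And>i j. i \<le> j \<Longrightarrow> \<beta> j \<le> \<beta> i"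
    using full_svd_exists[OF B] by metis
  have AB: "A - B \<in> carrier_mat m n" using A B by auto
  obtain V W \<delta> where svdD: "unitary_mat m V" "unitary_mat n W"
    "A - B = V * rect_diag m n \<delta> * mat_adjoint W" and \<delta>: "\<And>i. 0 \<le> \<delta> i" "\<And>i j. i \<le> j \<Longrightarrow> \<delta> j \<le> \<delta> i"
    using full_svd_exists[OF AB] by metis
  have sv: "singular_value A i = \<alpha> i" "singular_value B i = \<beta> i" "singular_value (A - B) i = \<delta> i"
    if "i < ?q" for i
    using singular_value_rect_diag[OF svdA \<alpha> that] singular_value_rect_diag[OF svdB \<beta> that]
      singular_value_rect_diag[OF svdD \<delta> that] by simp_all
  obtain E where E: "E \<in> carrier_mat ?N ?N" "mat_adjoint E = E"
    and trE: "(\<Sum>i<?N. E $$ (i, i)) = complex_of_real (\<Sum>l<?q. max 0 (\<delta> l - \<tau>))"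
    and Epos: "\<And>v. v \<in> carrier_vec ?N \<Longrightarrow> 0 \<le> Re ((E *\<^sub>v v) \<bullet>c v)"
    and Edom: "\<And>v. v \<in> carrier_vec ?N \<Longrightarrow>
      Re ((dilation (A - B) *\<^sub>v v) \<bullet>c v) \<le> \<tau> * sqnorm v + Re ((E *\<^sub>v v) \<bullet>c v)"
    using dilation_excess[OF svdD \<delta>(1) \<tau>] by blast
  define G where "G = dilation B + E"
  have HB: "dilation B \<in> carrier_mat ?N ?N" by (rule dilation_carrier[OF B])
  have G: "G \<in> carrier_mat ?N ?N" using HB E by (auto simp: G_def)
  have "mat_adjoint G = G"
  proof (rule eq_matI)
    fix i j assume "i < dim_row G" "j < dim_col G"
    then have ij: "i < ?N" "j < ?N" using G by auto
    have "cnj (dilation B $$ (j, i)) = dilation B $$ (i, j)" "cnj (E $$ (j, i)) = E $$ (i, j)"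
      using mat_adjoint_index[of i "dilation B" j] mat_adjoint_index[of i E j] ij HB E
      by (auto simp: dilation_adjoint)
    then show "mat_adjoint G $$ (i, j) = G $$ (i, j)"
      using ij HB E by (simp add: G_def)
  qed (use G in auto)
  then obtain Q \<mu> where Q: "unitary_mat ?N Q"
    and GQ: "G = Q * mat_diag ?N (\<lambda>i. complex_of_real (\<mu> i)) * mat_adjoint Q"
    and anti: "\<And>i j. i \<le> j \<Longrightarrow> j < ?N \<Longrightarrow> \<mu> j \<le> \<mu> i"
    using spectral_theorem[OF G] by metis
  note q = unitary_matD[OF Q]
  have Gform: "Re ((G *\<^sub>v v) \<bullet>c v) = Re ((dilation B *\<^sub>v v) \<bullet>c v) + Re ((E *\<^sub>v v) \<bullet>c v)"
    if v: "v \<in> carrier_vec ?N" for v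
  proof -
    have "G *\<^sub>v v = dilation B *\<^sub>v v + E *\<^sub>v v"
      unfolding G_def by (rule add_mult_distrib_mat_vec[OF HB E(1) v])
    then show ?thesis
      using HB E v by (simp add: add_scalar_prod_distrib[of _ ?N])
  qed
  have GB: "Re ((dilation B *\<^sub>v v) \<bullet>c v) \<le> Re ((G *\<^sub>v v) \<bullet>c v)" if v: "v \<in> carrier_vec ?N" for v
    using Gform[OF v] Epos[OF v] by simp
  have GA: "Re ((dilation A *\<^sub>v v) \<bullet>c v) - \<tau> * sqnorm v \<le> Re ((G *\<^sub>v v) \<bullet>c v)"
    if v: "v \<in> carrier_vec ?N" for v
  proof -
    let ?x = "vec_first v m" and ?y = "vec_last v n"
    have "(A - B) *\<^sub>v ?y = A *\<^sub>v ?y - B *\<^sub>v ?y"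
      by (rule minus_mult_distrib_mat_vec[OF A B]) simp
    then have "((A - B) *\<^sub>v ?y) \<bullet>c ?x = (A *\<^sub>v ?y) \<bullet>c ?x - (B *\<^sub>v ?y) \<bullet>c ?x"
      using A B by (simp add: minus_scalar_prod_distrib[of _ m])
    then have "Re ((dilation (A - B) *\<^sub>v v) \<bullet>c v) =
        Re ((dilation A *\<^sub>v v) \<bullet>c v) - Re ((dilation B *\<^sub>v v) \<bullet>c v)"
      by (simp add: dilation_form[OF _ v] A B AB)
    then show ?thesis
      using Edom[OF v] Gform[OF v] by linarith
  qed
  \<comment> \<open>Lower bounds for the eigenvalues of \<open>G\<close>, from \<open>H(B) \<le> G\<close> and \<open>H(A) - \<tau> \<le> G\<close>.\<close>
  have topB: "\<beta> i \<le> \<mu> i" if i: "i < ?q" for i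
  proof -
    obtain \<phi>s where \<phi>s: "\<And>\<phi>. \<phi> \<in> set \<phi>s \<Longrightarrow> linear_functional ?N \<phi>" "length \<phi>s + i < ?N"
      "\<And>v. v \<in> carrier_vec ?N \<Longrightarrow> \<forall>\<phi>\<in>set \<phi>s. \<phi> v = 0 \<Longrightarrow>
        \<beta> i * sqnorm v \<le> Re ((dilation B *\<^sub>v v) \<bullet>c v)"
      using dilation_top_subspace[OF svdB \<beta>(2) i] by blast
    show ?thesis
    proof (rule courant_fischer_lower_bound[OF Q GQ anti \<phi>s(1,2)])
      fix v assume "v \<in> carrier_vec ?N" "\<forall>\<phi>\<in>set \<phi>s. \<phi> v = 0"
      from \<phi>s(3)[OF this] GB[OF this(1)]
      show "\<beta> i * sqnorm v \<le> Re ((G *\<^sub>v v) \<bullet>c v)" by linarith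
    qed
  qed
  have topA: "\<alpha> i - \<tau> \<le> \<mu> i" if i: "i < ?q" for i
  proof -
    obtain \<phi>s where \<phi>s: "\<And>\<phi>. \<phi> \<in> set \<phi>s \<Longrightarrow> linear_functional ?N \<phi>" "length \<phi>s + i < ?N"
      "\<And>v. v \<in> carrier_vec ?N \<Longrightarrow> \<forall>\<phi>\<in>set \<phi>s. \<phi> v = 0 \<Longrightarrow>
        \<alpha> i * sqnorm v \<le> Re ((dilation A *\<^sub>v v) \<bullet>c v)"
      using dilation_top_subspace[OF svdA \<alpha>(2) i] by blast
    show ?thesis
    proof (rule courant_fischer_lower_bound[OF Q GQ anti \<phi>s(1,2)])
      fix v assume "v \<in> carrier_vec ?N" "\<forall>\<phi>\<in>set \<phi>s. \<phi> v = 0"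
      from \<phi>s(3)[OF this] GA[OF this(1)]
      show "(\<alpha> i - \<tau>) * sqnorm v \<le> Re ((G *\<^sub>v v) \<bullet>c v)"
        unfolding left_diff_distrib by linarith
    qed
  qed
  have botB: "- s \<le> \<mu> j" if i: "i \<le> ?q" and j: "i + j < ?N"
    and s: "0 \<le> s" "\<And>l. i \<le> l \<Longrightarrow> l < ?q \<Longrightarrow> \<beta> l \<le> s" for i j s
  proof -
    obtain \<phi>s where \<phi>s: "\<And>\<phi>. \<phi> \<in> set \<phi>s \<Longrightarrow> linear_functional ?N \<phi>" "length \<phi>s = i"
      "\<And>v. v \<in> carrier_vec ?N \<Longrightarrow> \<forall>\<phi>\<in>set \<phi>s. \<phi> v = 0 \<Longrightarrow>
        - s * sqnorm v \<le> Re ((dilation B *\<^sub>v v) \<bullet>c v)"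
      using dilation_bottom_subspace[OF svdB \<beta>(1) i s] by blast
    have len: "length \<phi>s + j < ?N" using \<phi>s(2) j by simp
    show ?thesis
    proof (rule courant_fischer_lower_bound[OF Q GQ anti \<phi>s(1) len])
      fix v assume "v \<in> carrier_vec ?N" "\<forall>\<phi>\<in>set \<phi>s. \<phi> v = 0"
      from \<phi>s(3)[OF this] GB[OF this(1)]
      show "- s * sqnorm v \<le> Re ((G *\<^sub>v v) \<bullet>c v)" by linarith
    qed
  qed
  have botA: "- \<alpha> i - \<tau> \<le> \<mu> (?N - 1 - i)" if i: "i < ?q" for i
  proof -
    have "i \<le> ?q" using i by simp
    obtain \<phi>s where \<phi>s: "\<And>\<phi>. \<phi> \<in> set \<phi>s \<Longrightarrow> linear_functional ?N \<phi>" "length \<phi>s = i"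
      "\<And>v. v \<in> carrier_vec ?N \<Longrightarrow> \<forall>\<phi>\<in>set \<phi>s. \<phi> v = 0 \<Longrightarrow>
        - \<alpha> i * sqnorm v \<le> Re ((dilation A *\<^sub>v v) \<bullet>c v)"
      using dilation_bottom_subspace[OF svdA \<alpha>(1) \<open>i \<le> ?q\<close> \<alpha>(1)[of i] \<alpha>(2)] by blast
    have len: "length \<phi>s + (?N - 1 - i) < ?N" using \<phi>s(2) i by auto
    show ?thesis
    proof (rule courant_fischer_lower_bound[OF Q GQ anti \<phi>s(1) len])
      fix v assume "v \<in> carrier_vec ?N" "\<forall>\<phi>\<in>set \<phi>s. \<phi> v = 0"
      from \<phi>s(3)[OF this] GA[OF this(1)]
      show "(- \<alpha> i - \<tau>) * sqnorm v \<le> Re ((G *\<^sub>v v) \<bullet>c v)"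
        unfolding left_diff_distrib by linarith
    qed
  qed
  have botB': "- \<beta> i \<le> \<mu> (?N - 1 - i)" if i: "i < ?q" for i
    using i by (intro botB[of i] \<beta>) auto
  have mid: "0 \<le> \<mu> i" if "?q \<le> i" "i < ?N - ?q" for i
    using botB[of ?q i 0] that by auto
  have "(\<Sum>i<?q. max 0 (\<bar>singular_value A i - singular_value B i\<bar> - \<tau>)) \<le> (\<Sum>i<?q. \<mu> i + \<mu> (?N - 1 - i))"
  proof (rule sum_mono)
    fix i assume "i \<in> {..<?q}"
    then have i: "i < ?q" by simp
    show "max 0 (\<bar>singular_value A i - singular_value B i\<bar> - \<tau>) \<le> \<mu> i + \<mu> (?N - 1 - i)"
      using topA[OF i] topB[OF i] botA[OF i] botB'[OF i] unfolding sv[OF i] by linarith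
  qed
  also have "\<dots> \<le> (\<Sum>i<?N. \<mu> i)"
    by (rule sum_ge_paired_ends) (use mid in auto)
  also have "\<dots> = (\<Sum>l<?q. max 0 (\<delta> l - \<tau>))"
  proof -
    have "complex_of_real (\<Sum>i<?N. \<mu> i) = (\<Sum>i<?N. G $$ (i, i))"
      unfolding GQ trace_diag[OF q(1)] by (simp add: unitary_sqnorm_col[OF Q])
    also have "\<dots> = (\<Sum>i<?N. E $$ (i, i))"
    proof (rule sum.cong[OF refl])
      fix i assume "i \<in> {..<?N}"
      moreover have "dilation B $$ (i, i) = 0" if "i < ?N"
        using that B by (auto simp: dilation_def)
      ultimately show "G $$ (i, i) = E $$ (i, i)" using HB E by (simp add: G_def)
    qed
    finally show ?thesis unfolding trE by (simp only: of_real_eq_iff)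
  qed
  also have "\<dots> = (\<Sum>i<?q. max 0 (singular_value (A - B) i - \<tau>))"
    by (intro sum.cong) (auto simp: sv)
  finally show ?thesis .
qed

section \<open>Symmetric gauge functions and weak majorization\<close>

lemma symmetric_gauge_abs_permute:
  assumes "symmetric_gauge q \<Phi>" "\<sigma> permutes {..<q}"
  shows "\<Phi> (vec q (\<lambda>i. \<bar>y (\<sigma> i)\<bar>)) = \<Phi> (vec q y)"
proof -
  have "\<Phi> (vec q y) = \<Phi> (vec q (\<lambda>i. \<bar>vec q y $ \<sigma> i\<bar>))"
  proof -
    have "\<forall>x \<in> carrier_vec q. \<forall>\<sigma>. \<sigma> permutes {..<q} \<longrightarrow> \<Phi> x = \<Phi> (vec q (\<lambda>i. \<bar>x $ \<sigma> i\<bar>))"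
      using assms(1) unfolding symmetric_gauge_def by (rule conjunct2)
    from this[rule_format, OF _ assms(2), of "vec q y"] show ?thesis by simp
  qed
  also have "vec q (\<lambda>i. \<bar>vec q y $ \<sigma> i\<bar>) = vec q (\<lambda>i. \<bar>y (\<sigma> i)\<bar>)"
    using permutes_in_image[OF assms(2)] by (intro eq_vecI) auto
  finally show ?thesis by simp
qed

lemma symmetric_gauge_abs_cong:
  assumes "symmetric_gauge q \<Phi>" "\<And>i. i < q \<Longrightarrow> \<bar>y i\<bar> = \<bar>z i\<bar>"
  shows "\<Phi> (vec q y) = \<Phi> (vec q z)"
proof -
  have "vec q (\<lambda>i. \<bar>y (id i)\<bar>) = vec q (\<lambda>i. \<bar>z (id i)\<bar>)"
    using assms(2) by (intro eq_vecI) auto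
  then show ?thesis
    using symmetric_gauge_abs_permute[OF assms(1) permutes_id, of y]
      symmetric_gauge_abs_permute[OF assms(1) permutes_id, of z] by simp
qed

text \<open>Every step of the majorization argument replaces \<open>y\<close> by a convex combination of \<open>y\<close> and a signed
permutation of \<open>y\<close>.\<close>

lemma symmetric_gauge_convex:
  assumes \<Phi>: "symmetric_gauge q \<Phi>" and t: "0 \<le> t" "t \<le> 1"
    and eq: "\<Phi> (vec q z) = \<Phi> (vec q y)"
    and x: "\<And>i. i < q \<Longrightarrow> x i = (1 - t) * y i + t * z i"
  shows "\<Phi> (vec q x) \<le> \<Phi> (vec q y)"
proof -
  have N: "norm_on_Rn q \<Phi>" using \<Phi> by (simp add: symmetric_gauge_def)
  have "vec q x = (1 - t) \<cdot>\<^sub>v vec q y + t \<cdot>\<^sub>v vec q z"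
    using x by (intro eq_vecI) auto
  moreover have tri: "\<Phi> (u + v) \<le> \<Phi> u + \<Phi> v" if "u \<in> carrier_vec q" "v \<in> carrier_vec q" for u v
    using N that unfolding norm_on_Rn_def by blast
  ultimately have "\<Phi> (vec q x) \<le> \<Phi> ((1 - t) \<cdot>\<^sub>v vec q y) + \<Phi> (t \<cdot>\<^sub>v vec q z)"
    by (simp only: tri smult_carrier_vec vec_carrier)
  also have "\<dots> = \<bar>1 - t\<bar> * \<Phi> (vec q y) + \<bar>t\<bar> * \<Phi> (vec q z)"
    using N by (simp add: norm_on_Rn_def)
  also have "\<dots> = \<Phi> (vec q y)"
    using t by (simp add: eq algebra_simps)
  finally show ?thesis .
qed

text \<open>An entry \<open>a \<le> y\<^sub>j\<close> is a convex combination of \<open>y\<^sub>j\<close> and \<open>-y\<^sub>j\<close>.\<close>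

lemma symmetric_gauge_shrink:
  assumes \<Phi>: "symmetric_gauge q \<Phi>" and a: "0 \<le> a" "a \<le> y j"
  shows "\<Phi> (vec q (y(j := a))) \<le> \<Phi> (vec q y)"
proof (cases "y j = 0")
  case True
  then have "y(j := a) = y" using a by auto
  then show ?thesis by simp
next
  case False
  then have pos: "y j > 0" using a by simp
  \<comment> \<open>the solution of \<open>a = (1 - t) y\<^sub>j - t y\<^sub>j\<close>\<close>
  define t where "t = (1 - a / y j) / 2"
  show ?thesis
  proof (rule symmetric_gauge_convex[OF \<Phi>, of t "y(j := - y j)"])
    show "0 \<le> t" "t \<le> 1" using a pos by (auto simp: t_def field_simps)
    show "\<Phi> (vec q (y(j := - y j))) = \<Phi> (vec q y)"
      by (rule symmetric_gauge_abs_cong[OF \<Phi>]) auto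
    show "(y(j := a)) i = (1 - t) * y i + t * (y(j := - y j)) i" for i
      using pos by (auto simp: t_def field_simps)
  qed
qed

text \<open>Moving the amount \<open>d\<close> from a larger entry to a smaller one, without overshooting their exchange, is averaging \<open>y\<close>
with the vector that has the two entries swapped.\<close>

lemma symmetric_gauge_transfer:
  assumes \<Phi>: "symmetric_gauge q \<Phi>" and nonneg: "\<And>i. i < q \<Longrightarrow> 0 \<le> y i"
    and jk: "j < q" "k < q" "j \<noteq> k" and d: "0 \<le> d" "d \<le> y j - y k"
  shows "\<Phi> (vec q (y(j := y j - d, k := y k + d))) \<le> \<Phi> (vec q y)"
proof (cases "y j = y k")
  case True
  then have "y(j := y j - d, k := y k + d) = y" using d by auto
  then show ?thesis by simp
next
  case False
  then have pos: "y j - y k > 0" using d by simp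
  define t where "t = d / (y j - y k)"
  show ?thesis
  proof (rule symmetric_gauge_convex[OF \<Phi>, of t "y \<circ> transpose j k"])
    show "0 \<le> t" "t \<le> 1" using d pos by (auto simp: t_def)
    have perm: "transpose j k permutes {..<q}"
      using jk by (intro permutes_swap_id) auto
    have "\<Phi> (vec q (y \<circ> transpose j k)) = \<Phi> (vec q (\<lambda>i. \<bar>y (transpose j k i)\<bar>))"
      by (rule symmetric_gauge_abs_cong[OF \<Phi>]) auto
    then show "\<Phi> (vec q (y \<circ> transpose j k)) = \<Phi> (vec q y)"
      using symmetric_gauge_abs_permute[OF \<Phi> perm] by simp
    have "t * (y j - y k) = d" using pos by (simp add: t_def)
    then show "(y(j := y j - d, k := y k + d)) i = (1 - t) * y i + t * (y \<circ> transpose j k) i" for i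
      using jk by (auto simp: transpose_def algebra_simps)
  qed
qed

text \<open>Each step makes another entry of \<open>y\<close> equal to that of \<open>x\<close>. If \<open>x \<le> y\<close>, shrink an entry. Otherwise let
\<open>k\<close> be the first index with \<open>x\<^sub>k > y\<^sub>k\<close>; the prefix sums force an earlier index with \<open>x\<^sub>j < y\<^sub>j\<close>, and as much as possible is
transferred from \<open>j\<close> to \<open>k\<close>. The prefix sums stay dominated, although \<open>y\<close> may cease to be sorted.\<close>

theorem symmetric_gauge_weak_majorization:
  fixes x y :: "nat \<Rightarrow> real"
  assumes \<Phi>: "symmetric_gauge q \<Phi>"
    and x: "\<And>i. i < q \<Longrightarrow> 0 \<le> x i" "\<And>i j. i \<le> j \<Longrightarrow> j < q \<Longrightarrow> x j \<le> x i"
    and y: "\<And>i. i < q \<Longrightarrow> 0 \<le> y i"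
    and prefix_sums: "\<And>p. p \<le> q \<Longrightarrow> (\<Sum>i<p. x i) \<le> (\<Sum>i<p. y i)"
  shows "\<Phi> (vec q x) \<le> \<Phi> (vec q y)"
  using y prefix_sums
proof (induction "card {i. i < q \<and> x i \<noteq> y i}" arbitrary: y rule: less_induct)
  case less
  note y = less.prems(1) and pre = less.prems(2)
  consider (eq) "\<forall>i<q. x i = y i" | (above) "\<exists>k<q. x k > y k"
    | (below) "\<forall>i<q. x i \<le> y i" "\<exists>j<q. x j < y j"
    by (meson linorder_neqE_linordered_idom not_less)
  then show ?case
  proof cases
    case eq
    then have "vec q x = vec q y" by (intro eq_vecI) auto
    then show ?thesis by simp
  next
    case below
    then obtain j where j: "j < q" "x j < y j" by blast
    let ?y = "y(j := x j)"
    have "\<Phi> (vec q x) \<le> \<Phi> (vec q ?y)"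
    proof (rule less.hyps[of ?y])
      have "{i. i < q \<and> x i \<noteq> ?y i} \<subseteq> {i. i < q \<and> x i \<noteq> y i}" by auto
      moreover have "j \<in> {i. i < q \<and> x i \<noteq> y i}" "j \<notin> {i. i < q \<and> x i \<noteq> ?y i}"
        using j by auto
      ultimately have "{i. i < q \<and> x i \<noteq> ?y i} \<subset> {i. i < q \<and> x i \<noteq> y i}" by blast
      then show "card {i. i < q \<and> x i \<noteq> ?y i} < card {i. i < q \<and> x i \<noteq> y i}"
        by (intro psubset_card_mono) simp_all
      show "0 \<le> ?y i" if "i < q" for i using y[OF that] x(1)[OF that] by auto
      show "(\<Sum>i<p. x i) \<le> (\<Sum>i<p. ?y i)" if "p \<le> q" for p
        using that below(1) by (intro sum_mono) auto
    qed
    also have "\<dots> \<le> \<Phi> (vec q y)"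
      using j x(1)[OF j(1)] by (intro symmetric_gauge_shrink[OF \<Phi>]) auto
    finally show ?thesis .
  next
    case above
    define k where "k = (LEAST k. k < q \<and> x k > y k)"
    have k: "k < q" "x k > y k"
      using LeastI_ex[OF above[unfolded Bex_def]] unfolding k_def by auto
    have le: "x i \<le> y i" if "i < k" for i
      using not_less_Least[of i "\<lambda>k. k < q \<and> x k > y k"] that k(1) by (auto simp flip: k_def)
    have "\<exists>j<k. x j < y j"
    proof (rule ccontr)
      assume "\<not> (\<exists>j<k. x j < y j)"
      then have "(\<Sum>i<k. x i) = (\<Sum>i<k. y i)"
        using le by (intro sum.cong) (auto simp: le_less)
      then show False using pre[of "Suc k"] k by simp
    qed
    then obtain j where j: "j < k" "x j < y j" by blast
    define d where "d = min (y j - x j) (x k - y k)"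
    have d: "0 < d" "d \<le> y j - x j" "d \<le> x k - y k" using j k by (auto simp: d_def)
    let ?y = "y(j := y j - d, k := y k + d)"
    have xjk: "x k \<le> x j" using x(2)[of j k] j k by simp
    have y_eq: "?y i = y i - (if i = j then d else 0) + (if i = k then d else 0)" for i
      using j by auto
    have sum_eq: "(\<Sum>i<p. ?y i) = (\<Sum>i<p. y i) - (if j < p then d else 0) + (if k < p then d else 0)" for p
      unfolding y_eq by (simp add: sum.distrib sum_subtractf)
    have "\<Phi> (vec q x) \<le> \<Phi> (vec q ?y)"
    proof (rule less.hyps[of ?y])
      have "x j = ?y j \<or> x k = ?y k" using j by (auto simp: d_def min_def)
      then have "j \<notin> {i. i < q \<and> x i \<noteq> ?y i} \<or> k \<notin> {i. i < q \<and> x i \<noteq> ?y i}"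
        by blast
      moreover have "{j, k} \<subseteq> {i. i < q \<and> x i \<noteq> y i}"
        using j k by simp
      moreover from this have "{i. i < q \<and> x i \<noteq> ?y i} \<subseteq> {i. i < q \<and> x i \<noteq> y i}"
        by auto
      ultimately have "{i. i < q \<and> x i \<noteq> ?y i} \<subset> {i. i < q \<and> x i \<noteq> y i}"
        by blast
      then show "card {i. i < q \<and> x i \<noteq> ?y i} < card {i. i < q \<and> x i \<noteq> y i}"
        by (intro psubset_card_mono) simp_all
      show "0 \<le> ?y i" if "i < q" for i
      proof -
        have "0 \<le> y j - d" using d(2) x(1)[of j] j(1) k(1) by linarith
        moreover have "0 \<le> y k + d" using d(1) y[OF k(1)] by linarith
        ultimately show ?thesis using y[OF that] by simp
      qed
      show "(\<Sum>i<p. x i) \<le> (\<Sum>i<p. ?y i)" if p: "p \<le> q" for p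
      proof (cases "j < p \<and> p \<le> k")
        case True
        \<comment> \<open>Before \<open>k\<close> all differences \<open>y\<^sub>i - x\<^sub>i\<close> are nonnegative, so the one at \<open>j\<close> leaves room for \<open>d\<close>.\<close>
        have "y j - x j \<le> (\<Sum>i<p. y i - x i)"
          using True le by (intro member_le_sum) auto
        then show ?thesis unfolding sum_eq using True d by (simp add: sum_subtractf)
      next
        case False
        then show ?thesis unfolding sum_eq using pre[OF p] j(1) by auto
      qed
    qed
    also have "\<dots> \<le> \<Phi> (vec q y)"
      using j k d xjk by (intro symmetric_gauge_transfer[OF \<Phi>] y) auto
    finally show ?thesis .
  qed
qed

text \<open>Take \<open>\<tau>\<close> to be the smallest of the first \<open>p\<close> entries of \<open>y\<close>: then exactly these entries contribute to the
excess of \<open>y\<close>.\<close>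

lemma prefix_sums_le_of_excess:
  fixes x y :: "nat \<Rightarrow> real"
  assumes y: "\<And>i. i < q \<Longrightarrow> 0 \<le> y i" "\<And>i j. i \<le> j \<Longrightarrow> j < q \<Longrightarrow> y j \<le> y i"
    and excess: "\<And>\<tau>. 0 \<le> \<tau> \<Longrightarrow> (\<Sum>i<q. max 0 (x i - \<tau>)) \<le> (\<Sum>i<q. max 0 (y i - \<tau>))"
    and p: "p \<le> q"
  shows "(\<Sum>i<p. x i) \<le> (\<Sum>i<p. y i)"
proof (cases p)
  case 0
  then show ?thesis by simp
next
  case (Suc r)
  define \<tau> where "\<tau> = y r"
  have r: "r < q" using Suc p by simp
  have "(\<Sum>i<p. x i) \<le> (\<Sum>i<p. \<tau> + max 0 (x i - \<tau>))"
    by (intro sum_mono) auto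
  also have "\<dots> \<le> (\<Sum>i<p. \<tau>) + (\<Sum>i<q. max 0 (x i - \<tau>))"
    unfolding sum.distrib using p by (intro add_left_mono sum_mono2) auto
  also have "\<dots> \<le> (\<Sum>i<p. \<tau>) + (\<Sum>i<q. max 0 (y i - \<tau>))"
    using excess[of \<tau>] y(1)[OF r] by (simp add: \<tau>_def)
  also have "(\<Sum>i<q. max 0 (y i - \<tau>)) = (\<Sum>i<p. y i - \<tau>)"
    using p r y(2)[of _ r] y(2)[of r] by (intro sum.mono_neutral_cong_right) (auto simp: Suc \<tau>_def less_Suc_eq_le not_less_eq)
  also have "(\<Sum>i<p. \<tau>) + (\<Sum>i<p. y i - \<tau>) = (\<Sum>i<p. y i)"
    by (simp add: sum_subtractf)
  finally show ?thesis .
qed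

section \<open>Partial isometries of rank k\<close>

lemma singular_value_nonneg_antitone:
  assumes A: "A \<in> carrier_mat m n" and i: "i < min m n"
  shows "0 \<le> singular_value A i" "j \<le> i \<Longrightarrow> singular_value A i \<le> singular_value A j"
proof -
  obtain V W \<sigma> where svd: "unitary_mat m V" "unitary_mat n W" "A = V * rect_diag m n \<sigma> * mat_adjoint W"
    and \<sigma>: "\<And>i. 0 \<le> \<sigma> i" "\<And>i j. i \<le> j \<Longrightarrow> \<sigma> j \<le> \<sigma> i"
    using full_svd_exists[OF A] by metis
  have sv: "singular_value A l = \<sigma> l" if "l < min m n" for l
    by (rule singular_value_rect_diag[OF svd \<sigma> that])
  show "0 \<le> singular_value A i" using sv[OF i] \<sigma> by simp
  show "singular_value A i \<le> singular_value A j" if "j \<le> i"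
    using sv[OF i] sv[of j] i that \<sigma>(2)[OF that] by simp
qed

lemma sqnorm_svd:
  assumes V: "unitary_mat m V" and W: "unitary_mat n W"
    and A: "A = V * rect_diag m n \<sigma> * mat_adjoint W" and f: "f \<in> carrier_vec n"
  shows "sqnorm (A *\<^sub>v f) = (\<Sum>l<min m n. (\<sigma> l)\<^sup>2 * (cmod (f \<bullet>c col W l))\<^sup>2)"
proof -
  note v = unitary_matD[OF V] and w = unitary_matD[OF W]
  let ?z = "mat_adjoint W *\<^sub>v f"
  have z: "?z \<in> carrier_vec n" using w by simp
  have Rz: "rect_diag m n \<sigma> *\<^sub>v ?z \<in> carrier_vec m" by simp
  have "A *\<^sub>v f = V *\<^sub>v (rect_diag m n \<sigma> *\<^sub>v ?z)"
    using v w f by (simp add: A assoc_mult_mat_vec_dim)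
  then have "sqnorm (A *\<^sub>v f) = sqnorm (rect_diag m n \<sigma> *\<^sub>v ?z)"
    using unitary_sqnorm[OF V Rz] by simp
  also have "\<dots> = (\<Sum>l<m. if l < n then (\<sigma> l)\<^sup>2 * (cmod (?z $ l))\<^sup>2 else 0)"
    unfolding sqnorm_carrier[OF Rz]
    by (intro sum.cong) (auto simp: rect_diag_mult_vec_index[OF z] norm_mult power_mult_distrib simp del: index_mult_mat_vec)
  also have "\<dots> = (\<Sum>l<min m n. (\<sigma> l)\<^sup>2 * (cmod (f \<bullet>c col W l))\<^sup>2)"
    using adjoint_mult_vec_index[OF w(1) f]
    by (intro sum.mono_neutral_cong_right) (auto simp del: index_mult_mat_vec)
  finally show ?thesis .
qed

lemma sqnorm_unitary_cols:
  assumes W: "unitary_mat n W" and f: "f \<in> carrier_vec n"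
  shows "sqnorm f = (\<Sum>l<n. (cmod (f \<bullet>c col W l))\<^sup>2)"
proof -
  note w = unitary_matD[OF W]
  have z: "mat_adjoint W *\<^sub>v f \<in> carrier_vec n" using w by simp
  have "sqnorm f = sqnorm (mat_adjoint W *\<^sub>v f)"
    using unitary_adjoint_sqnorm[OF W f] by simp
  also have "\<dots> = (\<Sum>l<n. (cmod (f \<bullet>c col W l))\<^sup>2)"
    unfolding sqnorm_carrier[OF z] using adjoint_mult_vec_index[OF w(1) f] by (intro sum.cong) auto
  finally show ?thesis .
qed

lemma mat_kernel_svd:
  assumes V: "unitary_mat m V" and W: "unitary_mat n W"
    and A: "A = V * rect_diag m n \<sigma> * mat_adjoint W" and f: "f \<in> carrier_vec n"
  shows "f \<in> mat_kernel A \<longleftrightarrow> (\<forall>l<min m n. \<sigma> l \<noteq> 0 \<longrightarrow> f \<bullet>c col W l = 0)"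
proof -
  have Ac: "A \<in> carrier_mat m n" using V W by (auto simp: A unitary_mat_def)
  have "f \<in> mat_kernel A \<longleftrightarrow> A *\<^sub>v f = 0\<^sub>v m"
    using f unfolding mat_kernel[OF Ac] by simp
  also have "\<dots> \<longleftrightarrow> sqnorm (A *\<^sub>v f) = 0"
    using Ac by (subst sqnorm_eq_0_iff[of _ m]) auto
  also have "\<dots> \<longleftrightarrow> (\<forall>l<min m n. \<sigma> l \<noteq> 0 \<longrightarrow> f \<bullet>c col W l = 0)"
    unfolding sqnorm_svd[OF V W A f] by (subst sum_nonneg_eq_0_iff) auto
  finally show ?thesis .
qed

text \<open>The orthogonal complement of the kernel is spanned by the columns of \<open>W\<close> with \<open>\<sigma>\<^sub>i \<noteq> 0\<close>, and \<open>A\<close> scales these by \<open>\<sigma>\<^sub>i\<close>.\<close>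

lemma partial_isometry_svd:
  assumes V: "unitary_mat m V" and W: "unitary_mat n W"
    and A: "A = V * rect_diag m n \<sigma> * mat_adjoint W" and nonneg: "\<And>i. 0 \<le> \<sigma> i"
  shows "partial_isometry A \<longleftrightarrow> (\<forall>i<min m n. \<sigma> i = 0 \<or> \<sigma> i = 1)"
proof -
  note w = unitary_matD[OF W]
  let ?q = "min m n"
  have dim: "dim_col A = n" using w by (simp add: A)
  have colW: "col W l \<in> carrier_vec n" if "l < n" for l using that w by auto
  have ort: "col W i \<bullet>c col W j = (if i = j then 1 else 0)" if "i < n" "j < n" for i j
    using W that unfolding unitary_mat_iff_cols[OF w(1)] by auto
  have compl: "f \<in> orth_compl n (mat_kernel A) \<longleftrightarrow>
      f \<in> carrier_vec n \<and> (\<forall>l<n. \<not> (l < ?q \<and> \<sigma> l \<noteq> 0) \<longrightarrow> f \<bullet>c col W l = 0)" for f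
  proof (intro iffI conjI allI impI)
    assume f: "f \<in> orth_compl n (mat_kernel A)"
    then show "f \<in> carrier_vec n" by (simp add: orth_compl_def)
    fix l assume l: "l < n" "\<not> (l < ?q \<and> \<sigma> l \<noteq> 0)"
    have "col W l \<in> mat_kernel A"
      unfolding mat_kernel_svd[OF V W A colW[OF l(1)]] using l ort by auto
    then show "f \<bullet>c col W l = 0" using f by (simp add: orth_compl_def)
  next
    assume f: "f \<in> carrier_vec n \<and> (\<forall>l<n. \<not> (l < ?q \<and> \<sigma> l \<noteq> 0) \<longrightarrow> f \<bullet>c col W l = 0)"
    have "f \<bullet>c g = 0" if g: "g \<in> mat_kernel A" for g
    proof -
      have gc: "g \<in> carrier_vec n" using g dim by (simp add: mat_kernel_def)
      have g0: "g \<bullet>c col W l = 0" if "l < ?q" "\<sigma> l \<noteq> 0" for l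
        using g that unfolding mat_kernel_svd[OF V W A gc] by blast
      have "f \<bullet>c g = (mat_adjoint W *\<^sub>v f) \<bullet>c (mat_adjoint W *\<^sub>v g)"
        using unitary_cscalar[OF unitary_mat_adjoint[OF W]] f gc by simp
      also have "\<dots> = (\<Sum>l<n. (f \<bullet>c col W l) * cnj (g \<bullet>c col W l))"
        using w f gc adjoint_mult_vec_index[OF w(1)]
        by (subst cscalar_sum[of _ n]) (auto simp del: index_mult_mat_vec)
      also have "\<dots> = 0"
      proof (rule sum.neutral, rule ballI)
        fix l assume "l \<in> {..<n}"
        then show "(f \<bullet>c col W l) * cnj (g \<bullet>c col W l) = 0"
          using f g0[of l] by (cases "l < ?q \<and> \<sigma> l \<noteq> 0") auto
      qed
      finally show ?thesis .
    qed
    then show "f \<in> orth_compl n (mat_kernel A)" using f by (simp add: orth_compl_def)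
  qed
  show ?thesis
  proof
    assume pi: "partial_isometry A"
    show "\<forall>i<?q. \<sigma> i = 0 \<or> \<sigma> i = 1"
    proof (intro allI impI)
      fix i assume i: "i < ?q"
      then have i': "i < n" by simp
      show "\<sigma> i = 0 \<or> \<sigma> i = 1"
      proof (cases "\<sigma> i = 0")
        case False
        have "col W i \<in> orth_compl n (mat_kernel A)"
          unfolding compl using colW[OF i'] ort[OF i'] False i by auto
        then have "sqrt (sqnorm (A *\<^sub>v col W i)) = sqrt (sqnorm (col W i))"
          using pi unfolding partial_isometry_def dim l2_norm_sqnorm by blast
        then have "sqnorm (A *\<^sub>v col W i) = sqnorm (col W i)"
          by simp
        moreover have "sqnorm (A *\<^sub>v col W i) = (\<Sum>l<?q. if l = i then (\<sigma> i)\<^sup>2 else 0)"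
          unfolding sqnorm_svd[OF V W A colW[OF i']] using ort[OF i'] by (intro sum.cong) auto
        moreover have "sqnorm (col W i) = (\<Sum>l<n. if l = i then 1 else 0)"
          unfolding sqnorm_unitary_cols[OF W colW[OF i']] using ort[OF i'] by (intro sum.cong) auto
        ultimately have "(\<sigma> i)\<^sup>2 = 1" using i by simp
        then show ?thesis using nonneg[of i] by (simp add: power2_eq_1_iff)
      qed simp
    qed
  next
    assume 01: "\<forall>i<?q. \<sigma> i = 0 \<or> \<sigma> i = 1"
    show "partial_isometry A"
      unfolding partial_isometry_def dim l2_norm_sqnorm
    proof
      fix f assume "f \<in> orth_compl n (mat_kernel A)"
      then have f: "f \<in> carrier_vec n" and f0: "\<And>l. l < n \<Longrightarrow> \<not> (l < ?q \<and> \<sigma> l \<noteq> 0) \<Longrightarrow> f \<bullet>c col W l = 0"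
        unfolding compl by auto
      have "sqnorm (A *\<^sub>v f) = (\<Sum>l<n. (cmod (f \<bullet>c col W l))\<^sup>2)"
        unfolding sqnorm_svd[OF V W A f]
      proof (rule sum.mono_neutral_cong_left)
        show "(\<sigma> l)\<^sup>2 * (cmod (f \<bullet>c col W l))\<^sup>2 = (cmod (f \<bullet>c col W l))\<^sup>2" if "l \<in> {..<?q}" for l
          using 01 f0[of l] that by (cases "\<sigma> l = 0") auto
        show "\<forall>l\<in>{..<n} - {..<?q}. (cmod (f \<bullet>c col W l))\<^sup>2 = 0"
          using f0 by auto
      qed auto
      then show "sqrt (sqnorm (A *\<^sub>v f)) = sqrt (sqnorm f)"
        using sqnorm_unitary_cols[OF W f] by simp
    qed
  qed
qed

lemma antitone_support_initial:
  fixes \<sigma> :: "nat \<Rightarrow> real"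
  assumes "\<And>i. 0 \<le> \<sigma> i" "\<And>i j. i \<le> j \<Longrightarrow> \<sigma> j \<le> \<sigma> i"
  obtains r where "r \<le> q" "\<And>i. i < q \<Longrightarrow> \<sigma> i \<noteq> 0 \<longleftrightarrow> i < r"
proof
  define r where "r = (LEAST i. i = q \<or> \<sigma> i = 0)"
  have r: "r = q \<or> \<sigma> r = 0"
    unfolding r_def by (rule LeastI[of _ q]) simp
  show "r \<le> q" unfolding r_def by (rule Least_le) simp
  show "\<sigma> i \<noteq> 0 \<longleftrightarrow> i < r" if "i < q" for i
  proof
    assume "\<sigma> i \<noteq> 0"
    then show "i < r"
      using r that assms(1)[of i] assms(2)[of r i] by (metis antisym not_less)
  next
    assume "i < r"
    then show "\<sigma> i \<noteq> 0"
      using not_less_Least[of i "\<lambda>i. i = q \<or> \<sigma> i = 0"] by (simp add: r_def)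
  qed
qed

lemma rank_le_min:
  fixes A :: "complex mat"
  assumes A: "A \<in> carrier_mat m n"
  shows "vec_space.rank m A \<le> min m n"
proof -
  obtain V W \<sigma> where svd: "unitary_mat m V" "unitary_mat n W" "A = V * rect_diag m n \<sigma> * mat_adjoint W"
    and \<sigma>: "\<And>i. 0 \<le> \<sigma> i" "\<And>i j. i \<le> j \<Longrightarrow> \<sigma> j \<le> \<sigma> i"
    using full_svd_exists[OF A] by metis
  obtain r where r: "r \<le> min m n" "\<And>i. i < min m n \<Longrightarrow> \<sigma> i \<noteq> 0 \<longleftrightarrow> i < r"
    using antitone_support_initial[where \<sigma> = \<sigma> and q = "min m n", OF \<sigma>] by metis
  show ?thesis using rank_rect_diag[OF svd r] r(1) by simp
qed

lemma singular_value_partial_isometry: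
  assumes X: "X \<in> partial_isometries m n k" and i: "i < min m n"
  shows "singular_value X i = (if i < k then 1 else 0)"
proof -
  have Xc: "X \<in> carrier_mat m n" and pi: "partial_isometry X" and rk: "vec_space.rank m X = k"
    using X by (auto simp: partial_isometries_def)
  obtain V W \<sigma> where svd: "unitary_mat m V" "unitary_mat n W" "X = V * rect_diag m n \<sigma> * mat_adjoint W"
    and \<sigma>: "\<And>i. 0 \<le> \<sigma> i" "\<And>i j. i \<le> j \<Longrightarrow> \<sigma> j \<le> \<sigma> i"
    using full_svd_exists[OF Xc] by metis
  obtain r where r: "r \<le> min m n" "\<And>i. i < min m n \<Longrightarrow> \<sigma> i \<noteq> 0 \<longleftrightarrow> i < r"
    using antitone_support_initial[where \<sigma> = \<sigma> and q = "min m n", OF \<sigma>] by metis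
  have "r = k" using rank_rect_diag[OF svd r] rk by simp
  then have "\<sigma> i = (if i < k then 1 else 0)"
    using r(2)[OF i] pi i unfolding partial_isometry_svd[OF svd \<sigma>(1)] by auto
  then show ?thesis
    using singular_value_rect_diag[OF svd \<sigma> i] by simp
qed

lemma corner_mat_diag:
  assumes "r \<le> min m n"
  shows "corner_mat m n r (mat_diag r (\<lambda>i. complex_of_real (d i))) =
    rect_diag m n (\<lambda>i. if i < r then d i else 0)"
  using assms by (intro eq_matI) (auto simp: corner_mat_def mat_diag_def)

lemma partial_isometries_rect_diag:
  assumes V: "unitary_mat m V" and W: "unitary_mat n W" and k: "k \<le> min m n"
  shows "V * rect_diag m n (\<lambda>i. if i < k then 1 else 0) * mat_adjoint W \<in> partial_isometries m n k"
    (is "?U \<in> _")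
proof -
  have "?U \<in> carrier_mat m n" using V W by (auto simp: unitary_mat_def)
  moreover have "partial_isometry ?U"
    using partial_isometry_svd[OF V W refl, of "\<lambda>i. if i < k then 1 else 0"] by simp
  moreover have "vec_space.rank m ?U = k"
    by (rule rank_rect_diag[OF V W refl k]) simp
  ultimately show ?thesis by (simp add: partial_isometries_def)
qed

lemma rect_diag_diff:
  assumes "V \<in> carrier_mat m m" "W' \<in> carrier_mat n n"
  shows "V * rect_diag m n \<alpha> * W' - V * rect_diag m n \<beta> * W' = V * rect_diag m n (\<lambda>i. \<alpha> i - \<beta> i) * W'"
proof -
  have "rect_diag m n (\<lambda>i. \<alpha> i - \<beta> i) = rect_diag m n \<alpha> - rect_diag m n \<beta>"
    by (intro eq_matI) auto
  then have "V * rect_diag m n (\<lambda>i. \<alpha> i - \<beta> i) = V * rect_diag m n \<alpha> - V * rect_diag m n \<beta>"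
    using assms by (simp add: mult_minus_distrib_mat[of _ m m _ n])
  moreover have "(V * rect_diag m n \<alpha> - V * rect_diag m n \<beta>) * W' =
      V * rect_diag m n \<alpha> * W' - V * rect_diag m n \<beta> * W'"
    using assms by (intro minus_mult_distrib_mat[of _ m n _ _ n]) auto
  ultimately show ?thesis by simp
qed

text \<open>In a given singular value decomposition the diagonal stops at the rank. The decomposition itself determines the
singular values, hence those beyond the rank vanish and the diagonal can be continued by them.\<close>

lemma singular_value_is_svd:
  assumes F: "F \<in> carrier_mat m n" and svd: "is_svd m n F V S W"
  obtains "unitary_mat m V" "unitary_mat n W" "F = V * rect_diag m n (singular_value F) * mat_adjoint W"
proof -
  define r where "r = vec_space.rank m F"
  define f where "f = (\<lambda>i. if i < r then singular_value F i else 0)"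
  have r: "r \<le> min m n" unfolding r_def by (rule rank_le_min[OF F])
  have V: "unitary_mat m V" and W: "unitary_mat n W" and
    S: "S = corner_mat m n r (mat_diag r (\<lambda>i. complex_of_real (singular_value F i)))" and
    FS: "F = V * S * mat_adjoint W"
    using svd unfolding is_svd_def Let_def r_def by blast+
  have "S = rect_diag m n f"
    unfolding f_def corner_mat_diag[OF r, symmetric] by (rule S)
  with FS have Ff: "F = V * rect_diag m n f * mat_adjoint W" by (rule subst[rotated])
  have "singular_value F i = f i" if "i < min m n" for i
  proof (rule singular_value_rect_diag[OF V W Ff _ _ that])
    show "0 \<le> f l" if "l < min m n" for l
      using singular_value_nonneg_antitone(1)[OF F that] by (simp add: f_def)
    show "f j \<le> f l" if "l \<le> j" "j < min m n" for l j
      using singular_value_nonneg_antitone(1)[OF F, of l]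
        singular_value_nonneg_antitone(2)[OF F that(2,1)] that by (auto simp: f_def)
  qed
  then have "rect_diag m n f = rect_diag m n (singular_value F)"
    by (intro eq_matI) auto
  from this Ff have "F = V * rect_diag m n (singular_value F) * mat_adjoint W" by (rule subst)
  with V W show ?thesis by (rule that)
qed

lemma sum_eq_of_mset_eq:
  fixes h :: "real \<Rightarrow> real"
  assumes "mset (map x [0..<q]) = mset (map y [0..<q])"
  shows "(\<Sum>i<q. h (x i)) = (\<Sum>i<q. h (y i))"
proof -
  have "(\<Sum>i<q. h (z i)) = sum_mset (image_mset h (mset (map z [0..<q])))" for z
    by (simp add: image_mset.compositionality comp_def sum_unfold_sum_mset lessThan_atLeast0)
  then show ?thesis using assms by simp
qed

lemma ui_norm_carrier: "A \<in> carrier_mat m n \<Longrightarrow> ui_norm \<Phi> A = \<Phi> (vec (min m n) (singular_value A))"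
  by (auto simp: ui_norm_def singular_values_def)

text \<open>The minimum is attained at \<open>U\<close> because \<open>F - U\<close> realizes the lower bound of Mirsky's inequality, with the same
comparison vector \<open>\<bar>s(F) - t\<bar>\<close> for all competitors.\<close>

theorem theorem3p1:
  fixes m n q k :: nat and F V S W U :: "complex mat"
  assumes "m \<ge> 1" and "n \<ge> 1" and "q = min m n" and "1 \<le> k" and "k \<le> q"
    and "F \<in> carrier_mat m n"
    and "is_svd m n F V S W"
    and "U = V * corner_mat m n k (1\<^sub>m k) * mat_adjoint W"
  shows "U \<in> partial_isometries m n k \<and>
    (\<forall>\<Phi>. symmetric_gauge q \<Phi> \<longrightarrow>
       ui_norm \<Phi> (F - U) \<in> {ui_norm \<Phi> (F - X) | X. X \<in> partial_isometries m n k} \<and>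
       (\<forall>y \<in> {ui_norm \<Phi> (F - X) | X. X \<in> partial_isometries m n k}. ui_norm \<Phi> (F - U) \<le> y))"
proof -
  note q = \<open>q = min m n\<close> and F = \<open>F \<in> carrier_mat m n\<close>
  have k: "k \<le> min m n" using assms by simp
  define t :: "nat \<Rightarrow> real" where "t = (\<lambda>i. if i < k then 1 else 0)"
  obtain V: "unitary_mat m V" and W: "unitary_mat n W"
    and FV: "F = V * rect_diag m n (singular_value F) * mat_adjoint W"
    by (rule singular_value_is_svd[OF F \<open>is_svd m n F V S W\<close>])
  have "corner_mat m n k (1\<^sub>m k) = rect_diag m n t"
    using corner_mat_diag[OF k, of "\<lambda>_. 1"] by (simp add: t_def)
  then have UV: "U = V * rect_diag m n t * mat_adjoint W"
    using assms by simp
  have U: "U \<in> partial_isometries m n k"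
    unfolding UV t_def by (rule partial_isometries_rect_diag[OF V W k])
  have FU: "F - U = V * rect_diag m n (\<lambda>i. singular_value F i - t i) * mat_adjoint W"
    unfolding UV by (subst FV) (intro rect_diag_diff unitary_matD V W)
  have FUc: "F - U \<in> carrier_mat m n"
    using F U by (auto simp: partial_isometries_def)
  have "ui_norm \<Phi> (F - U) \<le> ui_norm \<Phi> (F - X)"
    if \<Phi>: "symmetric_gauge q \<Phi>" and X: "X \<in> partial_isometries m n k" for \<Phi> X
  proof -
    have Xc: "X \<in> carrier_mat m n" using X by (simp add: partial_isometries_def)
    have FXc: "F - X \<in> carrier_mat m n" using F Xc by auto
    have excess: "(\<Sum>i<q. max 0 (singular_value (F - U) i - \<tau>)) \<le> (\<Sum>i<q. max 0 (singular_value (F - X) i - \<tau>))"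
      if "0 \<le> \<tau>" for \<tau>
    proof -
      have "(\<Sum>i<q. max 0 (singular_value (F - U) i - \<tau>)) = (\<Sum>i<q. max 0 (\<bar>singular_value F i - t i\<bar> - \<tau>))"
        using singular_values_of_rect_diag[OF V W FU]
        by (intro sum_eq_of_mset_eq[of _ _ _ "\<lambda>a. max 0 (a - \<tau>)"]) (simp add: q)
      also have "\<dots> = (\<Sum>i<q. max 0 (\<bar>singular_value F i - singular_value X i\<bar> - \<tau>))"
        using singular_value_partial_isometry[OF X] by (intro sum.cong) (auto simp: q t_def)
      also have "\<dots> \<le> (\<Sum>i<q. max 0 (singular_value (F - X) i - \<tau>))"
        unfolding q by (rule mirsky_excess[OF F Xc that])
      finally show ?thesis .
    qed
    note sv = singular_value_nonneg_antitone[folded q]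
    have "\<Phi> (vec q (singular_value (F - U))) \<le> \<Phi> (vec q (singular_value (F - X)))"
      by (intro symmetric_gauge_weak_majorization[OF \<Phi>] prefix_sums_le_of_excess[OF _ _ excess]
          sv[OF FUc] sv[OF FXc]) (simp_all add: q)
    then show ?thesis
      by (simp add: ui_norm_carrier[OF FUc] ui_norm_carrier[OF FXc] q)
  qed
  with U show ?thesis by blast
qed

end
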